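(* Let $\lambda,\mu$ be partitions with $|\lambda|=|\mu|$, and let $L^\lambda_\mu(t)=G_\mu(m_\lambda,t)$. Then $$L^\lambda_\mu(t)=\sum_{(\lambda^{(1)},\dots,\lambda^{(\ell(\mu))})\in\mathfrak R(\lambda,\mu)}\mathrm{RC}(\lambda^{(1)})\,\mathrm{RC}(\lambda^{(2)})\cdots\mathrm{RC}(\lambda^{(\ell(\mu))}).$$ In particular $L^\lambda_\mu(t)$ is independent of $t$, and it is zero unless $\lambda$ is a refinement of $\mu$.
   Context: $\Lambda$ is the algebra of symmetric functions over $\mathbb C$; $m_\lambda$ is the monomial symmetric function of type $\lambda$. $J_k=\sum_{s=1}^{k-1}(s,k)\in\mathbb C[S(n)]$ are the Jucys–Murphy elements and $f(\Xi_n)=f(J_1,\dots,J_n,0,0,\dots)$. The reduced cycle-type of a permutation of cycle type $\nu\vdash n$ (fixed points as parts $1$) is obtained by subtracting $1$ from each part of $\nu$; $\mathfrak c_\mu(n)$ is the sum of the permutations in $S(n)$ of reduced cycle-type $\mu$, and $\mathrm{wt}(\mu)=|\mu|+\ell(\mu)$. For $f\in\Lambda$, $G_\mu(f,t)\in\mathbb C[t]$ are the polynomials with $f(\Xi_n)=\sum_{\mathrm{wt}(\mu)\le n}G_\mu(f,n)\mathfrak c_\mu(n)$ for all $n\ge1$. For $k\ge1$, $\mathfrak E(k)$ is the set of weakly increasing sequences $(i_1,\dots,i_k)$ of positive integers with $i_p\ge p$ ($1\le p\le k-1$) and $i_k=k$; such a sequence is of type $\nu\vdash k$ if $\nu$ is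 the decreasing rearrangement of the nonzero multiplicities of the values $1,2,\dots$ in it; $\mathrm{RC}(\nu)$ is the number of sequences in $\mathfrak E(k)$ of type $\nu$ (and $\mathrm{RC}$ of the empty partition is $1$). For $\lambda,\mu\vdash k$, $\mathfrak R(\lambda,\mu)$ is the set of sequences $(\lambda^{(1)},\dots,\lambda^{(\ell(\mu))})$ of partitions with $\lambda^{(i)}\vdash\mu_i$ and $\lambda^{(1)}\cup\dots\cup\lambda^{(\ell(\mu))}=\lambda$ (union = all parts juxtaposed and sorted decreasingly); $\lambda$ is a refinement of $\mu$ if $\mathfrak R(\lambda,\mu)\neq\emptyset$. *)

theory Defs
  imports
    "HOL-Combinatorics.Perm"
    "HOL-Library.Poly_Mapping"
    "HOL-Library.Multiset"
    "HOL-Computational_Algebra.Polynomial"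
begin

section \<open>Partitions\<close>

definition is_partition :: "nat list \<Rightarrow> bool" where
  "is_partition \<mu> \<longleftrightarrow> sorted_wrt (\<ge>) \<mu> \<and> (\<forall>x\<in>set \<mu>. 0 < x)"

definition partition_of :: "nat list \<Rightarrow> nat \<Rightarrow> bool" (infix \<open>\<turnstile>\<close> 50) where
  "\<mu> \<turnstile> k \<longleftrightarrow> is_partition \<mu> \<and> sum_list \<mu> = k"

definition sort_desc :: "nat list \<Rightarrow> nat list" where
  "sort_desc xs = rev (sort xs)"

definition wt :: "nat list \<Rightarrow> nat" where
  "wt \<mu> = sum_list \<mu> + length \<mu>"


section \<open>Symmetric functions\<close>

text \<open>
  A formal power series over the complex numbers in countably many variables is the function
  mapping an exponent vector to its coefficient. Variables are numbered from \<open>0\<close>: the exponent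
  of \<open>x\<^bsub>i+1\<^esub>\<close> is stored at index \<open>i\<close>.
\<close>

type_synonym series = "(nat \<Rightarrow>\<^sub>0 nat) \<Rightarrow> complex"

definition symmetric_functions :: "series set" where
  "symmetric_functions =
    {f. (\<exists>d. \<forall>\<alpha>. f \<alpha> \<noteq> 0 \<longrightarrow> (\<Sum>i\<in>Poly_Mapping.keys \<alpha>. Poly_Mapping.lookup \<alpha> i) \<le> d) \<and>
        (\<forall>\<sigma> \<alpha>. bij \<sigma> \<longrightarrow> f (Poly_Mapping.map_key \<sigma> \<alpha>) = f \<alpha>)}"

definition exponent_type :: "(nat \<Rightarrow>\<^sub>0 nat) \<Rightarrow> nat list" where
  "exponent_type \<alpha> =
    sort_desc (map (Poly_Mapping.lookup \<alpha>) (sorted_list_of_set (Poly_Mapping.keys \<alpha>)))"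

definition monomial_sym :: "nat list \<Rightarrow> series" where
  "monomial_sym lam = (\<lambda>\<alpha>. if exponent_type \<alpha> = lam then 1 else 0)"

lemma mset_exponent_type:
  "mset (exponent_type \<alpha>) =
    image_mset (Poly_Mapping.lookup \<alpha>) (mset_set (Poly_Mapping.keys \<alpha>))"
  by (simp add: exponent_type_def sort_desc_def flip: sorted_list_of_mset_set)

lemma sort_desc_eq_iff: "sort_desc xs = sort_desc ys \<longleftrightarrow> mset xs = mset ys"
  unfolding sort_desc_def by (metis mset_sort rev_is_rev_conv properties_for_sort sorted_sort)

lemma exponent_type_map_key:
  assumes "bij \<sigma>"
  shows "exponent_type (Poly_Mapping.map_key \<sigma> \<alpha>) = exponent_type \<alpha>"
proof -
  have inj: "inj \<sigma>" using assms by (rule bij_is_inj)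
  let ?K = "Poly_Mapping.keys (Poly_Mapping.map_key \<sigma> \<alpha>)"
  have K: "?K = \<sigma> -` Poly_Mapping.keys \<alpha>" by (simp add: keys_map_key inj)
  have img: "\<sigma> ` ?K = Poly_Mapping.keys \<alpha>" unfolding K using assms by (simp add: bij_is_surj)
  have "image_mset (Poly_Mapping.lookup (Poly_Mapping.map_key \<sigma> \<alpha>)) (mset_set ?K)
      = image_mset (Poly_Mapping.lookup \<alpha>) (image_mset \<sigma> (mset_set ?K))"
    by (simp add: map_key.rep_eq inj multiset.map_comp comp_def)
  also have "image_mset \<sigma> (mset_set ?K) = mset_set (Poly_Mapping.keys \<alpha>)"
    using inj img by (metis image_mset_mset_set inj_on_subset subset_UNIV)
  finally show ?thesis
    by (simp add: exponent_type_def sort_desc_eq_iff flip: sorted_list_of_mset_set)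
qed

lemma monomial_sym_in_symmetric_functions: "monomial_sym lam \<in> symmetric_functions"
proof -
  have "(\<Sum>i\<in>Poly_Mapping.keys \<alpha>. Poly_Mapping.lookup \<alpha> i) = sum_list (exponent_type \<alpha>)" for \<alpha>
    by (metis mset_exponent_type sum_mset_sum_list sum_unfold_sum_mset)
  then show ?thesis
    by (auto simp: symmetric_functions_def monomial_sym_def exponent_type_map_key
        split: if_splits)
qed


section \<open>The group algebra of the symmetric groups\<close>

text \<open>
  The type \<open>'a \<Rightarrow>\<^sub>0 'b\<close> carries the convolution product of a monoid algebra, for
  an additively written (not necessarily commutative) monoid \<open>'a\<close>. Permutations are therefore
  also given an additive notation, with composition as \<open>+\<close>.
\<close>

instantiation Perm.perm :: (type) group_add
begin

definition zero_perm :: "'a perm" where "zero_perm = 1"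
definition plus_perm :: "'a perm \<Rightarrow> 'a perm \<Rightarrow> 'a perm" where "plus_perm p q = p * q"
definition uminus_perm :: "'a perm \<Rightarrow> 'a perm" where "uminus_perm p = inverse p"
definition minus_perm :: "'a perm \<Rightarrow> 'a perm \<Rightarrow> 'a perm" where "minus_perm p q = p * inverse q"

instance
  by standard
    (simp_all add: zero_perm_def plus_perm_def uminus_perm_def minus_perm_def mult.assoc)

end

text \<open>
  \<open>\<complex>[S(n)]\<close> is the subalgebra, of the algebra of all finitely supported permutations of the
  natural numbers, consisting of the elements whose keys lie in \<open>Sym_group n\<close>.
\<close>

type_synonym group_algebra = "nat perm \<Rightarrow>\<^sub>0 complex"

definition Sym_group :: "nat \<Rightarrow> nat perm set" where
  "Sym_group n = {p. affected p \<subseteq> {1..n}}"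

definition perm_elem :: "nat perm \<Rightarrow> group_algebra" where
  "perm_elem p = Poly_Mapping.single p 1"

definition scalar :: "complex \<Rightarrow> group_algebra" where
  "scalar c = Poly_Mapping.single 0 c"

definition jucys_murphy :: "nat \<Rightarrow> group_algebra" where
  "jucys_murphy k = (\<Sum>s\<in>{1..<k}. perm_elem (Perm.swap s k))"

text \<open>
  The value of \<open>f\<close> at \<open>(J\<^sub>1, \<dots>, J\<^sub>n, 0, 0, \<dots>)\<close>: only the monomials in the first
  \<open>n\<close> variables survive the substitution, and for a symmetric function there are finitely many
  of these with nonzero coefficient. The factors are multiplied in the order of their indices.
\<close>

definition eval_Xi :: "series \<Rightarrow> nat \<Rightarrow> group_algebra" where
  "eval_Xi f n =
    (\<Sum>\<alpha> | Poly_Mapping.keys \<alpha> \<subseteq> {..<n} \<and> f \<alpha> \<noteq> 0.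
      scalar (f \<alpha>) * prod_list (map (\<lambda>i. jucys_murphy (i + 1) ^ Poly_Mapping.lookup \<alpha> i) [0..<n]))"

definition cycle_type :: "nat \<Rightarrow> nat perm \<Rightarrow> nat list" where
  "cycle_type n p =
    rev (sorted_list_of_multiset (image_mset card (mset_set (Perm.orbit p ` {1..n}))))"

text \<open>Parts equal to \<open>1\<close> become \<open>0\<close> and are dropped, as partitions have positive parts.\<close>

definition reduced_cycle_type :: "nat \<Rightarrow> nat perm \<Rightarrow> nat list" where
  "reduced_cycle_type n p = filter (\<lambda>k. k \<noteq> 0) (map (\<lambda>k. k - 1) (cycle_type n p))"

definition class_sum :: "nat list \<Rightarrow> nat \<Rightarrow> group_algebra" where
  "class_sum \<mu> n = (\<Sum>p\<in>{p \<in> Sym_group n. reduced_cycle_type n p = \<mu>}. perm_elem p)"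

text \<open>
  \<open>class_poly f \<mu>\<close> is the polynomial \<open>G\<^sub>\<mu>(f, t)\<close>. The first condition fixes the irrelevant values
  at lists that are not partitions, so that the family is unique.
\<close>

definition class_poly :: "series \<Rightarrow> nat list \<Rightarrow> complex poly" where
  "class_poly f = (THE G.
    (\<forall>\<mu>. \<not> is_partition \<mu> \<longrightarrow> G \<mu> = 0) \<and>
    (\<forall>n\<ge>1. eval_Xi f n =
      (\<Sum>\<mu> | is_partition \<mu> \<and> wt \<mu> \<le> n. scalar (poly (G \<mu>) (of_nat n)) * class_sum \<mu> n)))"

definition L_poly :: "nat list \<Rightarrow> nat list \<Rightarrow> complex poly" where
  "L_poly lam \<mu> = class_poly (monomial_sym lam) \<mu>"


section \<open>Refined Catalan numbers and refinements\<close>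

definition catalan_seqs :: "nat \<Rightarrow> nat list set" where
  "catalan_seqs k =
    {i. length i = k \<and> sorted i \<and> (\<forall>x\<in>set i. 1 \<le> x) \<and>
        (\<forall>p\<in>{1..k - 1}. p \<le> i ! (p - 1)) \<and> i ! (k - 1) = k}"

definition seq_type :: "nat list \<Rightarrow> nat list" where
  "seq_type i = sort_desc (map (count_list i) (remdups i))"

definition RC :: "nat list \<Rightarrow> nat" where
  "RC \<nu> = (if \<nu> = [] then 1 else card {i \<in> catalan_seqs (sum_list \<nu>). seq_type i = \<nu>})"

definition refinements :: "nat list \<Rightarrow> nat list \<Rightarrow> nat list list set" where
  "refinements lam \<mu> =
    {ls. length ls = length \<mu> \<and> (\<forall>i<length \<mu>. ls ! i \<turnstile> \<mu> ! i) \<and> sort_desc (concat ls) = lam}"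

definition is_refinement :: "nat list \<Rightarrow> nat list \<Rightarrow> bool" where
  "is_refinement lam \<mu> \<longleftrightarrow> refinements lam \<mu> \<noteq> {}"

end

theory Submission
  imports Defs
begin

text \<open>
  The coefficient of a permutation \<open>p\<close> in \<open>m\<^sub>\<lambda>(\<Xi>\<^sub>n)\<close> is the number of factorizations of \<open>p\<close> into
  transpositions \<open>(s\<^sub>1 t\<^sub>1) \<cdots> (s\<^sub>k t\<^sub>k)\<close> with \<open>s\<^sub>i < t\<^sub>i \<le> n\<close>, \<open>t\<^sub>1 \<le> \<cdots> \<le> t\<^sub>k\<close>, in which the
  multiplicities of the values \<open>t\<^sub>i\<close> form \<open>\<lambda>\<close>. It is a class function because a transposition of
  adjacent numbers commutes with \<open>x\<^sup>ay\<^sup>b + x\<^sup>by\<^sup>a\<close> for the two corresponding Jucys-Murphy elements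
  \<open>x\<close>, \<open>y\<close>, and it is polynomial in \<open>n\<close> because the points outside the support of \<open>p\<close> can be
  relabelled monotonically.

  If \<open>|\<mu>| = |\<lambda>|\<close>, take for \<open>p\<close> a product of cycles on consecutive intervals. The factorization is
  then of minimal length, so every transposition stays inside one interval, and since the \<open>t\<^sub>i\<close>
  increase, the factorization is the concatenation of factorizations of the cycles. For the cycle
  \<open>(a, \<dots>, b)\<close> the last factor is some \<open>(s b)\<close>, and removing it leaves the cycles
  \<open>(a, \<dots>, s)\<close> and \<open>(s + 1, \<dots>, b)\<close>. By this Catalan recursion the sequence \<open>t\<close> determines the
  factorization, and the sequences that occur are those of \<open>\<EE>(b - a)\<close>, shifted by \<open>a\<close>.
\<close>

unbundle permutation_syntax

section \<open>Coefficients of products in the group algebra\<close>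

lemma lookup_scalar_mult:
  "Poly_Mapping.lookup (scalar c * X) p = c * Poly_Mapping.lookup X p"
  unfolding scalar_def mult_map_scale_conv_mult[symmetric]
  by (simp add: Poly_Mapping.map.rep_eq when_def)

lemma lookup_perm_elem: "Poly_Mapping.lookup (perm_elem p) q = (if p = q then 1 else 0)"
  by (simp add: perm_elem_def lookup_single when_def)

lemma perm_elem_mult: "perm_elem p * perm_elem q = perm_elem (p * q)"
  by (simp add: perm_elem_def mult_single plus_perm_def)

lemma perm_elem_one: "perm_elem 1 = 1"
  by (simp add: perm_elem_def flip: zero_perm_def)

lemma poly_mapping_eq_sum_single:
  "X = (\<Sum>k\<in>Poly_Mapping.keys X. Poly_Mapping.single k (Poly_Mapping.lookup X k))"
  by (rule poly_mapping_eqI) (simp add: lookup_sum lookup_single when_def in_keys_iff)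

lemma lookup_perm_elem_mult_left:
  "Poly_Mapping.lookup (perm_elem p * X) (p * q) = Poly_Mapping.lookup X q"
proof -
  have X: "X = (\<Sum>k\<in>Poly_Mapping.keys X. Poly_Mapping.single k (Poly_Mapping.lookup X k))"
    by (rule poly_mapping_eq_sum_single)
  have "Poly_Mapping.lookup (perm_elem p * X) (p * q) =
    (\<Sum>k\<in>Poly_Mapping.keys X. Poly_Mapping.lookup X k when p * k = p * q)"
    by (subst X) (simp add: sum_distrib_left lookup_sum perm_elem_def mult_single lookup_single
        plus_perm_def)
  also have "\<dots> = (\<Sum>k\<in>Poly_Mapping.keys X. if k = q then Poly_Mapping.lookup X k else 0)"
    by (intro sum.cong) (auto simp: when_def simp flip: plus_perm_def)
  finally show ?thesis by (auto simp: in_keys_iff)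
qed

lemma lookup_perm_elem_mult_right:
  "Poly_Mapping.lookup (X * perm_elem p) (q * p) = Poly_Mapping.lookup X q"
proof -
  have X: "X = (\<Sum>k\<in>Poly_Mapping.keys X. Poly_Mapping.single k (Poly_Mapping.lookup X k))"
    by (rule poly_mapping_eq_sum_single)
  have "Poly_Mapping.lookup (X * perm_elem p) (q * p) =
    (\<Sum>k\<in>Poly_Mapping.keys X. Poly_Mapping.lookup X k when k * p = q * p)"
    by (subst X) (simp add: sum_distrib_right lookup_sum perm_elem_def mult_single lookup_single
        plus_perm_def)
  also have "\<dots> = (\<Sum>k\<in>Poly_Mapping.keys X. if k = q then Poly_Mapping.lookup X k else 0)"
    by (intro sum.cong) (auto simp: when_def simp flip: plus_perm_def)
  finally show ?thesis by (auto simp: in_keys_iff)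
qed

text \<open>Conjugation relabels the two points of a transposition. The commutation rules for
  Jucys-Murphy elements below all reduce to this identity.\<close>

lemma perm_mult_swap: "p * \<langle>a \<leftrightarrow> b\<rangle> = \<langle>p \<langle>$\<rangle> a \<leftrightarrow> p \<langle>$\<rangle> b\<rangle> * p"
proof (rule perm_eqI)
  fix c
  show "(p * \<langle>a \<leftrightarrow> b\<rangle>) \<langle>$\<rangle> c = (\<langle>p \<langle>$\<rangle> a \<leftrightarrow> p \<langle>$\<rangle> b\<rangle> * p) \<langle>$\<rangle> c"
    by (cases "c = a"; cases "c = b") (auto simp: apply_times apply_inj)
qed

lemma bij_betw_apply: 
  assumes "affected p \<subseteq> A"
  shows "bij_betw (Perm.apply p) A A"
proof (rule bij_betw_imageI)
  show "inj_on (Perm.apply p) A" by (auto simp: inj_on_def apply_inj)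
  \<comment> \<open>Stated for every \<open>q\<close>, because surjectivity applies it to
    \<open>inverse p\<close>.\<close>
  have sub: "Perm.apply q ` A \<subseteq> A" if "affected q \<subseteq> A" for q
  proof
    fix y assume "y \<in> Perm.apply q ` A"
    then obtain x where x: "x \<in> A" "y = q \<langle>$\<rangle> x" by blast
    show "y \<in> A"
    proof (cases "x \<in> affected q")
      case True
      then have "y \<in> affected q" using x by simp
      then show ?thesis using that by blast
    qed (use x in \<open>auto simp: in_affected\<close>)
  qed
  have "x \<in> Perm.apply p ` A" if "x \<in> A" for x
  proof -
    have "inverse p \<langle>$\<rangle> x \<in> A" using sub[of "inverse p"] assms that by auto
    moreover have "p \<langle>$\<rangle> (inverse p \<langle>$\<rangle> x) = x" by (simp add: apply_sequence)
    ultimately show ?thesis by (metis imageI)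
  qed
  with sub[OF assms] show "Perm.apply p ` A = A" by blast
qed

section \<open>Symmetric functions of Jucys-Murphy elements are central\<close>

text \<open>Here \<open>p\<close> fixes \<open>k\<close> and permutes the smaller positive points,
  so conjugation by \<open>p\<close> only permutes the summands of
  \<open>jucys_murphy k\<close>.\<close>

lemma jucys_murphy_commute_below:
  assumes "affected p \<subseteq> {1..<k}"
  shows "perm_elem p * jucys_murphy k = jucys_murphy k * perm_elem p"
proof -
  have pk: "p \<langle>$\<rangle> k = k" using assms by (auto simp: in_affected)
  have "perm_elem p * jucys_murphy k = (\<Sum>s\<in>{1..<k}. perm_elem (\<langle>p \<langle>$\<rangle> s \<leftrightarrow> k\<rangle> * p))"
    by (simp add: jucys_murphy_def sum_distrib_left perm_elem_mult perm_mult_swap[of p] pk)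
  also have "\<dots> = (\<Sum>s\<in>{1..<k}. perm_elem (\<langle>s \<leftrightarrow> k\<rangle> * p))"
    by (rule sum.reindex_bij_betw[OF bij_betw_apply[OF assms]])
  finally show ?thesis by (simp add: jucys_murphy_def sum_distrib_right perm_elem_mult)
qed

text \<open>Conjugation by \<open>p\<close> now fixes every summand separately.\<close>

lemma jucys_murphy_commute_above:
  assumes "affected p \<inter> {1..k} = {}"
  shows "perm_elem p * jucys_murphy k = jucys_murphy k * perm_elem p"
proof -
  have "p * \<langle>s \<leftrightarrow> k\<rangle> = \<langle>s \<leftrightarrow> k\<rangle> * p" if "s \<in> {1..<k}" for s
  proof -
    have "p \<langle>$\<rangle> s = s" "p \<langle>$\<rangle> k = k" using assms that by (auto simp: in_affected)
    then show ?thesis by (simp add: perm_mult_swap[of p])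
  qed
  then show ?thesis
    by (simp add: jucys_murphy_def sum_distrib_left sum_distrib_right perm_elem_mult)
qed

lemma jucys_murphy_adjacent_commute:
  "jucys_murphy i * jucys_murphy (Suc i) = jucys_murphy (Suc i) * jucys_murphy i"
proof -
  have "perm_elem \<langle>s \<leftrightarrow> i\<rangle> * jucys_murphy (Suc i) = jucys_murphy (Suc i) * perm_elem \<langle>s \<leftrightarrow> i\<rangle>"
    if "s \<in> {1..<i}" for s
    using that by (intro jucys_murphy_commute_below) (auto simp: affected_swap)
  then show ?thesis
    by (subst (1 2) jucys_murphy_def[of i]) (simp add: sum_distrib_left sum_distrib_right)
qed

lemma jucys_murphy_Suc:
  assumes "1 \<le> i"
  shows "jucys_murphy (Suc i) = (\<Sum>s\<in>{1..<i}. perm_elem \<langle>s \<leftrightarrow> Suc i\<rangle>) + perm_elem \<langle>i \<leftrightarrow> Suc i\<rangle>"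
  using assms by (simp add: jucys_murphy_def sum.atLeastLessThan_Suc)

text \<open>These are the relations of the degenerate affine Hecke algebra. Conjugation by the
  adjacent transposition turns the summands of \<open>jucys_murphy i\<close> into those of
  \<open>jucys_murphy (Suc i)\<close>, except for the additional summand
  \<open>\<langle>i \<leftrightarrow> Suc i\<rangle>\<close>, whose square accounts for the
  1.\<close>

lemma swap_mult_jucys_murphy:
  assumes "1 \<le> i"
  shows "perm_elem \<langle>i \<leftrightarrow> Suc i\<rangle> * jucys_murphy i =
      jucys_murphy (Suc i) * perm_elem \<langle>i \<leftrightarrow> Suc i\<rangle> - 1"
    and "perm_elem \<langle>i \<leftrightarrow> Suc i\<rangle> * jucys_murphy (Suc i) =
      jucys_murphy i * perm_elem \<langle>i \<leftrightarrow> Suc i\<rangle> + 1"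
proof -
  have 1: "\<langle>i \<leftrightarrow> Suc i\<rangle> * \<langle>s \<leftrightarrow> i\<rangle> = \<langle>s \<leftrightarrow> Suc i\<rangle> * \<langle>i \<leftrightarrow> Suc i\<rangle>"
    and 2: "\<langle>i \<leftrightarrow> Suc i\<rangle> * \<langle>s \<leftrightarrow> Suc i\<rangle> = \<langle>s \<leftrightarrow> i\<rangle> * \<langle>i \<leftrightarrow> Suc i\<rangle>" if "s \<in> {1..<i}" for s
    using that by (simp_all add: perm_mult_swap[of "\<langle>i \<leftrightarrow> Suc i\<rangle>"])
  show "perm_elem \<langle>i \<leftrightarrow> Suc i\<rangle> * jucys_murphy i =
      jucys_murphy (Suc i) * perm_elem \<langle>i \<leftrightarrow> Suc i\<rangle> - 1"
    using 1 by (simp add: jucys_murphy_Suc[OF assms] distrib_right sum_distrib_left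
        sum_distrib_right jucys_murphy_def[of i] perm_elem_mult perm_elem_one)
  show "perm_elem \<langle>i \<leftrightarrow> Suc i\<rangle> * jucys_murphy (Suc i) =
      jucys_murphy i * perm_elem \<langle>i \<leftrightarrow> Suc i\<rangle> + 1"
    using 2 by (simp add: jucys_murphy_Suc[OF assms] distrib_left sum_distrib_left
        sum_distrib_right jucys_murphy_def[of i] perm_elem_mult perm_elem_one)
qed

section \<open>Elements commuting with the symmetric polynomials in two commuting elements of a
  ring\<close>

lemma commutes_mult:
  fixes s x y :: "'a :: ring_1"
  assumes "s * x = x * s" "s * y = y * s"
  shows "s * (x * y) = (x * y) * s"
  using assms by (metis mult.assoc)

lemma commutes_power:
  fixes s x :: "'a :: ring_1"
  assumes "s * x = x * s"
  shows "s * x ^ k = x ^ k * s"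
  using assms by (metis power_commuting_commutes)

lemma commutes_prod_list:
  fixes s :: "'a :: ring_1"
  assumes "\<And>x. x \<in> set xs \<Longrightarrow> s * x = x * s"
  shows "s * prod_list xs = prod_list xs * s"
  using assms by (induction xs) (auto intro: commutes_mult)

text \<open>Newton's recursion expresses each power sum through the two preceding ones, with
  coefficients \<open>x + y\<close> and \<open>- x * y\<close>; both of these commute with
  \<open>s\<close>.\<close>

lemma commutes_power_sum:
  fixes s x y :: "'a :: ring_1"
  assumes xy: "x * y = y * x"
    and add: "s * (x + y) = (x + y) * s" and mult: "s * (x * y) = (x * y) * s"
  shows "s * (x ^ k + y ^ k) = (x ^ k + y ^ k) * s"
proof (induction k rule: induct_nat_012)
  case (ge2 k)
  have "x ^ Suc (Suc k) + y ^ Suc (Suc k) =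
      (x + y) * (x ^ Suc k + y ^ Suc k) - (x * y) * (x ^ k + y ^ k)"
    using xy by (simp add: algebra_simps) (metis mult.assoc)
  moreover have "s * ((x + y) * (x ^ Suc k + y ^ Suc k)) = ((x + y) * (x ^ Suc k + y ^ Suc k)) * s"
    using add ge2(2) by (rule commutes_mult)
  moreover have "s * ((x * y) * (x ^ k + y ^ k)) = ((x * y) * (x ^ k + y ^ k)) * s"
    using mult ge2(1) by (rule commutes_mult)
  ultimately show ?case by (simp only: left_diff_distrib right_diff_distrib)
qed (use add in \<open>simp_all add: mult_2 mult_2_right\<close>)

lemma power_mult_distrib_commuting:
  fixes x y :: "'a :: monoid_mult"
  assumes "x * y = y * x"
  shows "(x * y) ^ k = x ^ k * y ^ k"
proof (induction k)
  case (Suc k)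
  have "y * x ^ k = x ^ k * y" using assms by (metis power_commuting_commutes)
  then have "x * y * (x ^ k * y ^ k) = x * x ^ k * (y * y ^ k)" by (metis mult.assoc)
  with Suc show ?case by simp
qed simp

text \<open>Extracting the largest common power of \<open>x * y\<close> leaves a power sum, which is
  covered by \<open>commutes_power_sum\<close>.\<close>

lemma commutes_symmetrized_monomial:
  fixes s x y :: "'a :: ring_1"
  assumes xy: "x * y = y * x"
    and add: "s * (x + y) = (x + y) * s" and mult: "s * (x * y) = (x * y) * s"
  shows "s * (x ^ a * y ^ b + x ^ b * y ^ a) = (x ^ a * y ^ b + x ^ b * y ^ a) * s"
proof -
  have *: "s * (x ^ (b + c) * y ^ b + x ^ b * y ^ (b + c)) =
      (x ^ (b + c) * y ^ b + x ^ b * y ^ (b + c)) * s" for b c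
  proof -
    have "y ^ c * x ^ b = x ^ b * y ^ c" "x ^ c * y ^ b = y ^ b * x ^ c"
      using xy by (metis power_commuting_commutes)+
    then have "x ^ (b + c) * y ^ b + x ^ b * y ^ (b + c) = (x * y) ^ b * (x ^ c + y ^ c)"
      by (simp add: power_add distrib_left power_mult_distrib_commuting[OF xy] mult.assoc)
    then show ?thesis
      using commutes_mult[OF commutes_power[OF mult] commutes_power_sum[OF xy add mult]]
      by simp
  qed
  show ?thesis
  proof (cases "b \<le> a")
    case True
    then show ?thesis using *[of b "a - b"] by simp
  next
    case False
    then show ?thesis using *[of a "b - a"] by (simp add: add.commute)
  qed
qed


abbreviation jm_monomial :: "nat \<Rightarrow> (nat \<Rightarrow>\<^sub>0 nat) \<Rightarrow> group_algebra" where
  "jm_monomial n \<alpha> \<equiv>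
    prod_list (map (\<lambda>i. jucys_murphy (i + 1) ^ Poly_Mapping.lookup \<alpha> i) [0..<n])"

lemma eval_monomial_sym:
  "eval_Xi (monomial_sym lam) n =
    (\<Sum>\<alpha> | Poly_Mapping.keys \<alpha> \<subseteq> {..<n} \<and> exponent_type \<alpha> = lam. jm_monomial n \<alpha>)"
  unfolding eval_Xi_def by (rule sum.cong) (auto simp: monomial_sym_def scalar_def)

text \<open>Exchanging the exponents of two neighbouring variables permutes the monomials of a given
  type. A monomial plus its mirror image is a symmetrized product of powers of the two neighbouring
  Jucys-Murphy elements, placed between factors that commute with the transposition. Exponent index
  \<open>j\<close> belongs to \<open>jucys_murphy (Suc j)\<close>.\<close>

lemma eval_monomial_sym_commutes_adjacent_swap:
  assumes "Suc j < n"
  shows "perm_elem \<langle>Suc j \<leftrightarrow> Suc (Suc j)\<rangle> * eval_Xi (monomial_sym lam) n =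
    eval_Xi (monomial_sym lam) n * perm_elem \<langle>Suc j \<leftrightarrow> Suc (Suc j)\<rangle>"
proof -
  define s where "s = perm_elem \<langle>Suc j \<leftrightarrow> Suc (Suc j)\<rangle>"
  define \<sigma> where "\<sigma> = Transposition.transpose j (Suc j)"
  define S where "S = {\<alpha>. Poly_Mapping.keys \<alpha> \<subseteq> {..<n} \<and> exponent_type \<alpha> = lam}"
  define X where "X = eval_Xi (monomial_sym lam) n"
  have bij: "bij \<sigma>" and inv: "\<sigma> (\<sigma> x) = x" for x by (simp_all add: \<sigma>_def)
  have \<sigma>_simps: "\<sigma> j = Suc j" "\<sigma> (Suc j) = j" "x \<noteq> j \<Longrightarrow> x \<noteq> Suc j \<Longrightarrow> \<sigma> x = x" for x
    by (simp_all add: \<sigma>_def)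
  have look: "Poly_Mapping.lookup (Poly_Mapping.map_key \<sigma> \<alpha>) x = Poly_Mapping.lookup \<alpha> (\<sigma> x)"
    for \<alpha> :: "nat \<Rightarrow>\<^sub>0 nat" and x
    by (simp add: map_key.rep_eq bij_is_inj[OF bij])
  have twice: "Poly_Mapping.map_key \<sigma> (Poly_Mapping.map_key \<sigma> \<alpha>) = \<alpha>" for \<alpha> :: "nat \<Rightarrow>\<^sub>0 nat"
    by (rule poly_mapping_eqI) (simp add: look inv)
  have inS: "Poly_Mapping.map_key \<sigma> \<alpha> \<in> S" if "\<alpha> \<in> S" for \<alpha>
  proof -
    have "x < n" if x: "x \<in> Poly_Mapping.keys (Poly_Mapping.map_key \<sigma> \<alpha>)" for x
    proof -
      have "\<sigma> x \<in> Poly_Mapping.keys \<alpha>" using x by (simp add: in_keys_iff look)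
      then have "\<sigma> x < n" using \<open>\<alpha> \<in> S\<close> by (auto simp: S_def)
      then show ?thesis using assms by (auto simp: \<sigma>_def transpose_def split: if_splits)
    qed
    then show ?thesis using that by (auto simp: S_def exponent_type_map_key[OF bij])
  qed
  have X: "X = (\<Sum>\<alpha>\<in>S. jm_monomial n \<alpha>)"
    by (simp add: X_def S_def eval_monomial_sym)
  have X': "X = (\<Sum>\<alpha>\<in>S. jm_monomial n (Poly_Mapping.map_key \<sigma> \<alpha>))"
    unfolding X
    by (rule sum.reindex_bij_witness[where i = "Poly_Mapping.map_key \<sigma>"
          and j = "Poly_Mapping.map_key \<sigma>"])
      (auto simp: twice inS)
  have comm: "s * (jm_monomial n \<alpha> + jm_monomial n (Poly_Mapping.map_key \<sigma> \<alpha>)) =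
    (jm_monomial n \<alpha> + jm_monomial n (Poly_Mapping.map_key \<sigma> \<alpha>)) * s" for \<alpha>
  proof -
    let ?f = "\<lambda>i. jucys_murphy (i + 1) ^ Poly_Mapping.lookup \<alpha> i"
    let ?x = "jucys_murphy (Suc j)" and ?y = "jucys_murphy (Suc (Suc j))"
    let ?a = "Poly_Mapping.lookup \<alpha> j" and ?b = "Poly_Mapping.lookup \<alpha> (Suc j)"
    define A where "A = prod_list (map ?f [0..<j])"
    define B where "B = prod_list (map ?f [Suc (Suc j)..<n])"
    have "[0..<n] = [0..<j] @ [j..<n]"
      using assms upt_add_eq_append[of 0 j "n - j"] by simp
    then have split: "[0..<n] = [0..<j] @ j # Suc j # [Suc (Suc j)..<n]"
      using assms by (simp add: upt_conv_Cons)
    have 1: "jm_monomial n \<alpha> = A * (?x ^ ?a * ?y ^ ?b) * B"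
      by (simp add: split A_def B_def mult.assoc)
    have outer: "map (\<lambda>i. jucys_murphy (i + 1) ^ Poly_Mapping.lookup \<alpha> (\<sigma> i)) [0..<j] = map ?f [0..<j]"
      "map (\<lambda>i. jucys_murphy (i + 1) ^ Poly_Mapping.lookup \<alpha> (\<sigma> i)) [Suc (Suc j)..<n] =
        map ?f [Suc (Suc j)..<n]"
      by (auto simp: \<sigma>_simps)
    have 2: "jm_monomial n (Poly_Mapping.map_key \<sigma> \<alpha>) = A * (?x ^ ?b * ?y ^ ?a) * B"
      unfolding split A_def B_def look map_append list.map outer by (simp add: mult.assoc \<sigma>_simps)
    have sA: "s * A = A * s" unfolding A_def s_def
      by (intro commutes_prod_list)
        (auto intro!: commutes_power jucys_murphy_commute_above simp: affected_swap)
    have sB: "s * B = B * s" unfolding B_def s_def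
      by (intro commutes_prod_list)
        (auto intro!: commutes_power jucys_murphy_commute_below simp: affected_swap)
    note sx = swap_mult_jucys_murphy[of "Suc j", folded s_def, simplified]
    have "s * (?x ^ ?a * ?y ^ ?b + ?x ^ ?b * ?y ^ ?a) = (?x ^ ?a * ?y ^ ?b + ?x ^ ?b * ?y ^ ?a) * s"
    proof (rule commutes_symmetrized_monomial)
      show "?x * ?y = ?y * ?x" by (rule jucys_murphy_adjacent_commute)
      show "s * (?x + ?y) = (?x + ?y) * s" by (simp add: distrib_left distrib_right sx)
      \<comment> \<open>The corrections -1 and +1 of the two Hecke relations cancel here.\<close>
      have "s * (?x * ?y) = ?y * (s * ?y) - ?y"
        by (simp add: sx(1) left_diff_distrib flip: mult.assoc)
      also have "\<dots> = ?y * ?x * s" by (simp add: sx(2) distrib_left mult.assoc)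
      finally show "s * (?x * ?y) = ?x * ?y * s" by (simp add: jucys_murphy_adjacent_commute)
    qed
    then have "s * (A * (?x ^ ?a * ?y ^ ?b + ?x ^ ?b * ?y ^ ?a) * B) =
        (A * (?x ^ ?a * ?y ^ ?b + ?x ^ ?b * ?y ^ ?a) * B) * s"
      by (intro commutes_mult sA sB)
    then show ?thesis unfolding 1 2 by (simp only: distrib_left distrib_right)
  qed
  \<comment> \<open>Doubling the sum treats exponent vectors fixed by the exchange like all others;
    the factor 2 is cancelled on coefficients at the end.\<close>
  have "X + X = (\<Sum>\<alpha>\<in>S. jm_monomial n \<alpha> + jm_monomial n (Poly_Mapping.map_key \<sigma> \<alpha>))"
    by (simp only: sum.distrib X[symmetric] X'[symmetric])
  then have "s * (X + X) = (X + X) * s"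
    using comm by (simp add: sum_distrib_left sum_distrib_right)
  then have "s * X + s * X = X * s + X * s" by (simp add: distrib_left distrib_right)
  then have "Poly_Mapping.lookup (s * X + s * X) p = Poly_Mapping.lookup (X * s + X * s) p" for p
    by simp
  then have "2 * Poly_Mapping.lookup (s * X) p = 2 * Poly_Mapping.lookup (X * s) p" for p
    by (simp only: lookup_add mult_2)
  then have "Poly_Mapping.lookup (s * X) p = Poly_Mapping.lookup (X * s) p" for p
    by simp
  then show ?thesis unfolding s_def X_def by (rule poly_mapping_eqI)
qed

text \<open>Adjacent transpositions generate the group: their conjugates give all transpositions,
  and one transposition returns the image of the largest point to its place, leaving a permutation
  of fewer points.\<close>

lemma Sym_group_induct [consumes 1, case_names one swap]:
  assumes "p \<in> Sym_group n"
    and one: "P 1"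
    and swap: "\<And>i p. 1 \<le> i \<Longrightarrow> i < n \<Longrightarrow> P p \<Longrightarrow> P (\<langle>i \<leftrightarrow> Suc i\<rangle> * p)"
  shows "P p"
proof -
  have trans: "P p \<Longrightarrow> P (\<langle>i \<leftrightarrow> i + d\<rangle> * p)" if "1 \<le> i" "i + d \<le> n" for i d p
    using that
  proof (induction d arbitrary: p)
    case (Suc d)
    show ?case
    proof (cases "d = 0")
      case True
      then show ?thesis using swap[of i p] Suc.prems by simp
    next
      case False
      \<comment> \<open>The transposition \<open>\<langle>i \<leftrightarrow> i + d\<rangle>\<close>
        is conjugated by the next adjacent one. For \<open>d = 0\<close> this would move the point
        \<open>i\<close> as well, hence the case distinction.\<close>
      have "\<langle>i \<leftrightarrow> i + Suc d\<rangle> = \<langle>i + d \<leftrightarrow> Suc (i + d)\<rangle> * (\<langle>i \<leftrightarrow> i + d\<rangle> * \<langle>i + d \<leftrightarrow> Suc (i + d)\<rangle>)"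
        using False by (simp add: perm_mult_swap[of "\<langle>i + d \<leftrightarrow> Suc (i + d)\<rangle>"] flip: mult.assoc)
          (simp add: mult.assoc)
      then have "\<langle>i \<leftrightarrow> i + Suc d\<rangle> * p = \<langle>i + d \<leftrightarrow> Suc (i + d)\<rangle> * (\<langle>i \<leftrightarrow> i + d\<rangle> * (\<langle>i + d \<leftrightarrow> Suc (i + d)\<rangle> * p))"
        by (simp add: mult.assoc)
      moreover have "P (\<langle>i + d \<leftrightarrow> Suc (i + d)\<rangle> * p)" using Suc.prems by (intro swap) auto
      ultimately show ?thesis using Suc.IH Suc.prems by (auto intro!: swap)
    qed
  qed simp
  have "P p" if "p \<in> Sym_group m" "m \<le> n" for m p
    using that
  proof (induction m arbitrary: p)
    case 0
    then have "p = 1" by (simp add: Sym_group_def)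
    then show ?case using one by simp
  next
    case (Suc m)
    define i where "i = p \<langle>$\<rangle> (Suc m)"
    have i: "1 \<le> i" "i \<le> Suc m"
      using bij_betw_apply[of p "{1..Suc m}"] Suc.prems by (auto simp: Sym_group_def i_def bij_betw_def)
    define q where "q = \<langle>i \<leftrightarrow> Suc m\<rangle> * p"
    have "affected \<langle>i \<leftrightarrow> Suc m\<rangle> \<subseteq> {1..Suc m}"
      using i by (cases "i = Suc m") (auto simp: affected_swap)
    then have "affected q \<subseteq> {1..Suc m}"
      using affected_times[of "\<langle>i \<leftrightarrow> Suc m\<rangle>" p] Suc.prems unfolding q_def Sym_group_def by blast
    moreover have "Suc m \<notin> affected q" by (simp add: in_affected q_def apply_times i_def)
    ultimately have "q \<in> Sym_group m" by (auto simp: Sym_group_def dest!: subsetD) (metis le_Suc_eq)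
    then have "P q" using Suc by simp
    then have "P (\<langle>i \<leftrightarrow> i + (Suc m - i)\<rangle> * q)" using i Suc.prems by (intro trans) auto
    moreover have "\<langle>i \<leftrightarrow> Suc m\<rangle> * q = p" by (simp add: q_def flip: mult.assoc)
    ultimately show ?case using i by simp
  qed
  then show ?thesis using assms(1) by blast
qed

text \<open>The evaluated symmetric function commutes with all of \<open>Sym_group n\<close>.
  Comparing the coefficients at \<open>\<sigma> * p = q * \<sigma>\<close> in its two products with
  \<open>\<sigma>\<close> gives the claim.\<close>

lemma lookup_eval_monomial_sym_conj:
  assumes "\<sigma> \<in> Sym_group n" "\<sigma> * p = q * \<sigma>"
  shows "Poly_Mapping.lookup (eval_Xi (monomial_sym lam) n) p =
    Poly_Mapping.lookup (eval_Xi (monomial_sym lam) n) q"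
proof -
  define X where "X = eval_Xi (monomial_sym lam) n"
  have "perm_elem \<sigma> * X = X * perm_elem \<sigma>"
    using assms(1)
  proof (induction rule: Sym_group_induct)
    case (swap i p)
    have "perm_elem \<langle>i \<leftrightarrow> Suc i\<rangle> * X = X * perm_elem \<langle>i \<leftrightarrow> Suc i\<rangle>"
      using eval_monomial_sym_commutes_adjacent_swap[of "i - 1" n lam] swap unfolding X_def by simp
    with swap.IH show ?case by (metis mult.assoc perm_elem_mult)
  qed (simp add: perm_elem_one)
  then show ?thesis
    using lookup_perm_elem_mult_left[of \<sigma> X p] lookup_perm_elem_mult_right[of X \<sigma> q] assms(2)
    unfolding X_def by simp
qed

section \<open>Coefficients count monotone factorizations\<close>

definition transp_prod :: "(nat \<times> nat) list \<Rightarrow> nat perm" where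
  "transp_prod l = prod_list (map (\<lambda>(s, t). \<langle>s \<leftrightarrow> t\<rangle>) l)"

text \<open>The ground set is variable: it is \<open>{1..n}\<close> for the coefficients,
  \<open>{1..w} \<union> S\<close> in the count as a function of \<open>n\<close>, and an interval
  for a single cycle.\<close>

definition mono_factorizations :: "nat set \<Rightarrow> nat perm \<Rightarrow> (nat \<times> nat) list set" where
  "mono_factorizations A p = {l. sorted (map snd l) \<and>
     (\<forall>(s, t)\<in>set l. s \<in> A \<and> t \<in> A \<and> s < t) \<and> transp_prod l = p}"

lemma transp_prod_Nil [simp]: "transp_prod [] = 1"
  and transp_prod_Cons: "transp_prod ((s, t) # l) = \<langle>s \<leftrightarrow> t\<rangle> * transp_prod l"
  and transp_prod_append: "transp_prod (l @ l') = transp_prod l * transp_prod l'"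
  by (simp_all add: transp_prod_def)

section \<open>Words of indices, their types, and the expansion of monomials\<close>

lemma mset_seq_type: "mset (seq_type ts) = image_mset (count (mset ts)) (mset_set (set ts))"
proof -
  have "mset (remdups ts) = mset_set (set ts)"
    using mset_set_set[of "remdups ts"] by simp
  moreover have "count (mset ts) = count_list ts" by (simp add: fun_eq_iff count_mset)
  ultimately show ?thesis by (simp add: seq_type_def sort_desc_def)
qed

lemma sum_list_seq_type: "sum_list (seq_type ts) = length ts"
proof -
  have "sum_list (seq_type ts) = (\<Sum>x\<in>set ts. count (mset ts) x)"
    by (metis mset_seq_type sum_mset_sum_list sum_unfold_sum_mset)
  also have "\<dots> = length ts" by (metis set_mset_mset size_mset size_multiset_overloaded_eq)
  finally show ?thesis .
qed

lemma sort_desc_id: "sorted_wrt (\<ge>) xs \<Longrightarrow> sort_desc xs = xs"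
  unfolding sort_desc_def by (metis mset_rev properties_for_sort rev_rev_ident sorted_wrt_rev)

lemma sort_desc_mset_eq_iff:
  assumes "sorted_wrt (\<ge>) lam"
  shows "sort_desc xs = lam \<longleftrightarrow> mset xs = mset lam"
  by (metis assms sort_desc_eq_iff sort_desc_id)

lemma seq_type_eq_iff:
  assumes "sorted_wrt (\<ge>) lam"
  shows "seq_type ts = lam \<longleftrightarrow> mset (seq_type ts) = mset lam"
  unfolding seq_type_def sort_desc_mset_eq_iff[OF assms] by (simp add: sort_desc_def)

text \<open>The word \<open>ts\<close> prescribes the larger points; expanding the product chooses
  the smaller point of each transposition.\<close>

lemma prod_list_jucys_murphy:
  "prod_list (map jucys_murphy ts) =
    (\<Sum>l | map snd l = ts \<and> (\<forall>(s, t)\<in>set l. 1 \<le> s \<and> s < t). perm_elem (transp_prod l))"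
proof (induction ts)
  case Nil
  have "{l. map snd l = [] \<and> (\<forall>(s, t)\<in>set l. 1 \<le> s \<and> s < t)} = {[] :: (nat \<times> nat) list}" by auto
  then show ?case by (simp only:) (simp add: perm_elem_one)
next
  case (Cons t ts)
  let ?S = "\<lambda>ts. {l. map snd l = ts \<and> (\<forall>(s, t)\<in>set l. 1 \<le> s \<and> s < t)} :: (nat \<times> nat) list set"
  have eq: "?S (t # ts) = (\<lambda>(s, l). (s, t) # l) ` ({1..<t} \<times> ?S ts)"
    by (auto simp: image_iff map_eq_Cons_conv)
  have "prod_list (map jucys_murphy (t # ts)) =
      (\<Sum>(s, l)\<in>{1..<t} \<times> ?S ts. perm_elem (transp_prod ((s, t) # l)))"
    by (simp only: list.map prod_list.Cons Cons jucys_murphy_def sum_product sum.cartesian_product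
        perm_elem_mult transp_prod_Cons)
  also have "\<dots> = (\<Sum>l\<in>?S (t # ts). perm_elem (transp_prod l))"
    unfolding eq by (subst sum.reindex) (auto simp: inj_on_def case_prod_unfold)
  finally show ?case .
qed

text \<open>Encodes a monomial as the sorted list of the indices of its Jucys-Murphy factors. The
  successor compensates for the numbering of variables from 0.\<close>

definition exponent_word :: "nat \<Rightarrow> (nat \<Rightarrow>\<^sub>0 nat) \<Rightarrow> nat list" where
  "exponent_word n \<alpha> = concat (map (\<lambda>i. replicate (Poly_Mapping.lookup \<alpha> i) (Suc i)) [0..<n])"

lemma exponent_word_Suc:
  "exponent_word (Suc n) \<alpha> = exponent_word n \<alpha> @ replicate (Poly_Mapping.lookup \<alpha> n) (Suc n)"
  by (simp add: exponent_word_def)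

lemma jm_monomial_eq_exponent_word:
  "jm_monomial n \<alpha> = prod_list (map jucys_murphy (exponent_word n \<alpha>))"
  by (induction n) (simp_all add: exponent_word_Suc exponent_word_def[of 0] prod_list_replicate)

lemma set_exponent_word_subset: "set (exponent_word n \<alpha>) \<subseteq> {1..n}"
  by (auto simp: exponent_word_def)

lemma sorted_exponent_word: "sorted (exponent_word n \<alpha>)"
proof (induction n)
  case (Suc n)
  then show ?case using set_exponent_word_subset[of n \<alpha>]
    by (fastforce simp: exponent_word_Suc sorted_append)
qed (simp add: exponent_word_def)

lemma count_exponent_word:
  "count (mset (exponent_word n \<alpha>)) (Suc i) = (if i < n then Poly_Mapping.lookup \<alpha> i else 0)"
  by (induction n) (auto simp: exponent_word_Suc exponent_word_def[of 0])

lemma seq_type_exponent_word: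
  assumes "Poly_Mapping.keys \<alpha> \<subseteq> {..<n}"
  shows "seq_type (exponent_word n \<alpha>) = exponent_type \<alpha>"
proof -
  have set: "set (exponent_word n \<alpha>) = Suc ` Poly_Mapping.keys \<alpha>"
    using assms by (auto simp: exponent_word_def in_keys_iff image_iff subset_iff)
  have "image_mset (count (mset (exponent_word n \<alpha>))) (mset_set (Suc ` Poly_Mapping.keys \<alpha>)) =
    image_mset (\<lambda>i. count (mset (exponent_word n \<alpha>)) (Suc i)) (mset_set (Poly_Mapping.keys \<alpha>))"
    by (subst image_mset_mset_set[symmetric]) (simp_all add: multiset.map_comp comp_def)
  also have "\<dots> = image_mset (Poly_Mapping.lookup \<alpha>) (mset_set (Poly_Mapping.keys \<alpha>))"
    using assms by (intro image_mset_cong) (auto simp: count_exponent_word)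
  finally have "mset (seq_type (exponent_word n \<alpha>)) = mset (exponent_type \<alpha>)"
    by (simp add: mset_seq_type set mset_exponent_type)
  then show ?thesis
    by (simp add: seq_type_def exponent_type_def sort_desc_eq_iff) (simp add: sort_desc_def)
qed

text \<open>A sorted word is determined by the multiplicities of its letters, and these
  multiplicities are the exponents.\<close>

lemma bij_betw_exponent_word:
  "bij_betw (exponent_word n) {\<alpha>. Poly_Mapping.keys \<alpha> \<subseteq> {..<n} \<and> exponent_type \<alpha> = lam}
    {ts. sorted ts \<and> set ts \<subseteq> {1..n} \<and> seq_type ts = lam}"
proof (rule bij_betw_imageI)
  show "inj_on (exponent_word n) {\<alpha>. Poly_Mapping.keys \<alpha> \<subseteq> {..<n} \<and> exponent_type \<alpha> = lam}"
  proof (rule inj_onI, rule poly_mapping_eqI)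
    fix \<alpha> \<beta> i
    assume *: "\<alpha> \<in> {\<alpha>. Poly_Mapping.keys \<alpha> \<subseteq> {..<n} \<and> exponent_type \<alpha> = lam}"
      "\<beta> \<in> {\<alpha>. Poly_Mapping.keys \<alpha> \<subseteq> {..<n} \<and> exponent_type \<alpha> = lam}"
      "exponent_word n \<alpha> = exponent_word n \<beta>"
    show "Poly_Mapping.lookup \<alpha> i = Poly_Mapping.lookup \<beta> i"
    proof (cases "i < n")
      case True
      then show ?thesis using count_exponent_word[of n \<alpha> i] count_exponent_word[of n \<beta> i] *(3) by simp
    next
      case False
      then have "i \<notin> Poly_Mapping.keys \<alpha>" "i \<notin> Poly_Mapping.keys \<beta>" using * by auto
      then show ?thesis by (simp add: in_keys_iff)
    qed
  qed
  have "ts \<in> exponent_word n ` {\<alpha>. Poly_Mapping.keys \<alpha> \<subseteq> {..<n} \<and> exponent_type \<alpha> = lam}"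
    if ts: "sorted ts" "set ts \<subseteq> {1..n}" "seq_type ts = lam" for ts
  proof -
    define \<alpha> where "\<alpha> = Abs_poly_mapping (\<lambda>i. count (mset ts) (Suc i))"
    have sub: "{i. count (mset ts) (Suc i) \<noteq> 0} \<subseteq> {..<n}" using ts(2) by (auto simp: subset_iff)
    then have "finite {i. count (mset ts) (Suc i) \<noteq> 0}" by (rule finite_subset) simp
    then have look: "Poly_Mapping.lookup \<alpha> = (\<lambda>i. count (mset ts) (Suc i))"
      unfolding \<alpha>_def by (rule lookup_Abs_poly_mapping)
    have keys: "Poly_Mapping.keys \<alpha> \<subseteq> {..<n}"
      unfolding Poly_Mapping.keys.rep_eq look using sub by blast
    have "mset (exponent_word n \<alpha>) = mset ts"
    proof (rule multiset_eqI)
      fix x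
      show "count (mset (exponent_word n \<alpha>)) x = count (mset ts) x"
      proof (cases x)
        case 0
        have "0 \<notin> set ts" "0 \<notin> set (exponent_word n \<alpha>)"
          using ts(2) set_exponent_word_subset[of n \<alpha>] by auto
        with 0 show ?thesis by (simp add: count_mset)
      next
        case (Suc i)
        then show ?thesis using sub by (auto simp: count_exponent_word look count_eq_zero_iff)
      qed
    qed
    then have w: "exponent_word n \<alpha> = ts"
      using ts(1) sorted_exponent_word[of n \<alpha>] by (metis properties_for_sort)
    then have "exponent_type \<alpha> = lam" using seq_type_exponent_word[OF keys] ts(3) by simp
    with keys w show ?thesis by (metis (mono_tags, lifting) imageI mem_Collect_eq)
  qed
  then have "{ts. sorted ts \<and> set ts \<subseteq> {1..n} \<and> seq_type ts = lam} \<subseteq>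
      exponent_word n ` {\<alpha>. Poly_Mapping.keys \<alpha> \<subseteq> {..<n} \<and> exponent_type \<alpha> = lam}" by blast
  moreover have "exponent_word n \<alpha> \<in> {ts. sorted ts \<and> set ts \<subseteq> {1..n} \<and> seq_type ts = lam}"
    if "Poly_Mapping.keys \<alpha> \<subseteq> {..<n}" "exponent_type \<alpha> = lam" for \<alpha>
    using that set_exponent_word_subset[of n \<alpha>]
    by (simp add: sorted_exponent_word seq_type_exponent_word)
  ultimately show "exponent_word n ` {\<alpha>. Poly_Mapping.keys \<alpha> \<subseteq> {..<n} \<and> exponent_type \<alpha> = lam} =
      {ts. sorted ts \<and> set ts \<subseteq> {1..n} \<and> seq_type ts = lam}"
    by blast
qed

definition mono_factorizations_type ::
  "nat list \<Rightarrow> nat set \<Rightarrow> nat perm \<Rightarrow> (nat \<times> nat) list set" where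
  "mono_factorizations_type lam A p = {l \<in> mono_factorizations A p. seq_type (map snd l) = lam}"

text \<open>Each monomial becomes a sorted word, and the expansion of the corresponding product runs
  over the factorizations having that word of larger points. Taking all words of type
  \<open>lam\<close> together gives all factorizations of that type.\<close>

lemma lookup_eval_monomial_sym:
  "Poly_Mapping.lookup (eval_Xi (monomial_sym lam) n) p =
    of_nat (card (mono_factorizations_type lam {1..n} p))"
proof -
  define T where "T = {ts. sorted ts \<and> set ts \<subseteq> {1..n} \<and> seq_type ts = lam}"
  define L where "L = {l. map snd l \<in> T \<and> (\<forall>(s, t)\<in>set l. 1 \<le> s \<and> s < t)}"
  have T: "finite T"
    by (rule finite_subset[OF _ finite_lists_length_eq[of "{1..n}" "sum_list lam"]])
      (auto simp: T_def sum_list_seq_type)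
  have L: "finite L"
  proof (rule finite_subset[OF _ finite_lists_length_eq[of "{1..n} \<times> {1..n}" "sum_list lam"]])
    show "L \<subseteq> {xs. set xs \<subseteq> {1..n} \<times> {1..n} \<and> length xs = sum_list lam}"
    proof safe
      fix l assume l: "l \<in> L"
      then show "length l = sum_list lam"
        using sum_list_seq_type[of "map snd l"] by (auto simp: L_def T_def)
      fix s t assume st: "(s, t) \<in> set l"
      then have "t \<in> set (map snd l)" by force
      then show "s \<in> {1..n}" "t \<in> {1..n}" using l st by (fastforce simp: L_def T_def)+
    qed
  qed simp
  have "eval_Xi (monomial_sym lam) n = (\<Sum>ts\<in>T. prod_list (map jucys_murphy ts))"
    unfolding eval_monomial_sym T_def jm_monomial_eq_exponent_word
    by (rule sum.reindex_bij_betw[OF bij_betw_exponent_word])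
  also have "\<dots> = (\<Sum>ts\<in>T. \<Sum>l\<in>{l \<in> L. map snd l = ts}. perm_elem (transp_prod l))"
    unfolding prod_list_jucys_murphy by (intro sum.cong) (auto simp: L_def)
  also have "\<dots> = (\<Sum>l\<in>L. perm_elem (transp_prod l))"
    by (rule sum.group[OF L T]) (auto simp: L_def)
  finally have "Poly_Mapping.lookup (eval_Xi (monomial_sym lam) n) p =
    (\<Sum>l\<in>L. if transp_prod l = p then 1 else 0)"
    by (simp add: lookup_sum lookup_perm_elem)
  also have "\<dots> = of_nat (card {l \<in> L. transp_prod l = p})"
    by (subst sum.inter_filter[OF L, symmetric]) simp
  also have "{l \<in> L. transp_prod l = p} = mono_factorizations_type lam {1..n} p"
  proof -
    have "set (map snd l) \<subseteq> {1..n} \<and> (\<forall>(s, t)\<in>set l. 1 \<le> s \<and> s < t) \<longleftrightarrow>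
      (\<forall>(s, t)\<in>set l. s \<in> {1..n} \<and> t \<in> {1..n} \<and> s < t)" for l :: "(nat \<times> nat) list"
      by (induction l) auto
    then show ?thesis
      unfolding L_def T_def mono_factorizations_type_def mono_factorizations_def by blast
  qed
  finally show ?thesis .
qed

section \<open>Polynomial dependence on the rank\<close>

text \<open>All points occurring in some transposition, including those that the product fixes. The
  latter are the source of the dependence on \<open>n\<close>.\<close>

definition moved_points :: "(nat \<times> nat) list \<Rightarrow> nat set" where
  "moved_points l = fst ` set l \<union> snd ` set l"

lemma transp_prod_apply_outside:
  "x \<notin> moved_points l \<Longrightarrow> transp_prod l \<langle>$\<rangle> x = x"
proof (induction l)
  case (Cons a l)
  then show ?case by (cases a) (auto simp: transp_prod_Cons moved_points_def apply_times)
qed simp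

lemma affected_transp_prod: "affected (transp_prod l) \<subseteq> moved_points l"
  using transp_prod_apply_outside[of _ l] unfolding subset_iff in_affected by blast

lemma moved_points_subset_iff:
  "moved_points l \<subseteq> A \<longleftrightarrow> (\<forall>(s, t)\<in>set l. s \<in> A \<and> t \<in> A)"
  by (auto simp: moved_points_def)

lemma mono_factorizations_alt:
  "l \<in> mono_factorizations A p \<longleftrightarrow> sorted (map snd l) \<and> moved_points l \<subseteq> A \<and>
    (\<forall>(s, t)\<in>set l. s < t) \<and> transp_prod l = p"
  unfolding mono_factorizations_def moved_points_subset_iff by auto

lemma finite_mono_factorizations_type:
  assumes "finite A"
  shows "finite (mono_factorizations_type lam A p)"
proof (rule finite_subset)
  show "mono_factorizations_type lam A p \<subseteq> {l. set l \<subseteq> A \<times> A \<and> length l = sum_list lam}"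
    by (auto simp: mono_factorizations_type_def mono_factorizations_def sum_list_seq_type)
  show "finite {l. set l \<subseteq> A \<times> A \<and> length l = sum_list lam}"
    using assms by (intro finite_lists_length_eq) simp
qed

lemma seq_type_map_inj:
  assumes "inj_on f (set ts)"
  shows "seq_type (map f ts) = seq_type ts"
proof -
  have "image_mset (count (mset (map f ts))) (mset_set (f ` set ts)) =
    image_mset (\<lambda>x. count (mset (map f ts)) (f x)) (mset_set (set ts))"
    using assms by (simp add: multiset.map_comp comp_def flip: image_mset_mset_set)
  also have "\<dots> = image_mset (count (mset ts)) (mset_set (set ts))"
    using assms by (intro image_mset_cong) (simp add: count_mset count_list_inj_map del: mset_map)
  finally have "mset (seq_type (map f ts)) = mset (seq_type ts)"
    by (simp add: mset_seq_type)
  then show ?thesis by (simp add: seq_type_def sort_desc_eq_iff) (simp add: sort_desc_def)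
qed

text \<open>The second conjunct keeps the induction inside \<open>B\<close>, where \<open>f\<close>
  is known to be injective.\<close>

lemma transp_prod_relabel:
  assumes "inj_on f B" "moved_points l \<subseteq> B" "x \<in> B"
  shows "transp_prod (map (map_prod f f) l) \<langle>$\<rangle> (f x) = f (transp_prod l \<langle>$\<rangle> x) \<and>
    transp_prod l \<langle>$\<rangle> x \<in> B"
  using assms(2)
proof (induction l)
  case Nil
  then show ?case using assms(3) by simp
next
  case (Cons a l)
  obtain s t where a: "a = (s, t)" by (cases a)
  define y where "y = transp_prod l \<langle>$\<rangle> x"
  have st: "s \<in> B" "t \<in> B" "moved_points l \<subseteq> B" using Cons.prems by (auto simp: a moved_points_def)
  then have y: "transp_prod (map (map_prod f f) l) \<langle>$\<rangle> (f x) = f y" "y \<in> B"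
    using Cons.IH by (auto simp: y_def)
  have "\<langle>f s \<leftrightarrow> f t\<rangle> \<langle>$\<rangle> (f y) = f (\<langle>s \<leftrightarrow> t\<rangle> \<langle>$\<rangle> y)"
  proof (cases "y = s \<or> y = t")
    case False
    then have "f y \<noteq> f s" "f y \<noteq> f t" using assms(1) st y(2) by (auto simp: inj_on_def)
    then show ?thesis using False by simp
  qed auto
  moreover have "\<langle>s \<leftrightarrow> t\<rangle> \<langle>$\<rangle> y \<in> B" using st y(2) by (cases "y = s \<or> y = t") auto
  ultimately show ?case by (simp add: a transp_prod_Cons apply_times y flip: y_def)
qed

lemma ex_strict_mono_on_same_card:
  fixes S S' :: "nat set"
  assumes "finite S" "finite S'" "card S = card S'"
  obtains f where "strict_mono_on S f" "f ` S = S'"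
proof -
  obtain h where h: "bij_betw h {..<card S} S" "strict_mono_on {..<card S} h"
    using ex_bij_betw_strict_mono_card[OF assms(1)] by blast
  obtain h' where h': "bij_betw h' {..<card S} S'" "strict_mono_on {..<card S} h'"
    using ex_bij_betw_strict_mono_card[OF assms(2)] assms(3) by metis
  define g where "g = inv_into {..<card S} h"
  have g: "bij_betw g S {..<card S}" unfolding g_def by (rule bij_betw_inv_into[OF h(1)])
  have hg: "h (g x) = x" if "x \<in> S" for x
    unfolding g_def by (rule bij_betw_inv_into_right[OF h(1) that])
  have gS: "g x < card S" if "x \<in> S" for x using g that by (auto simp: bij_betw_def)
  have "strict_mono_on S (h' \<circ> g)"
  proof (rule strict_mono_onI)
    fix x y assume xy: "x \<in> S" "y \<in> S" "x < y"
    have "g x < g y"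
    proof (rule ccontr)
      assume "\<not> g x < g y"
      then have "h (g y) \<le> h (g x)"
        using h(2) gS xy by (simp add: strict_mono_on_leD)
      then show False using hg xy by simp
    qed
    then show "(h' \<circ> g) x < (h' \<circ> g) y"
      using h'(2) gS xy by (simp add: strict_mono_onD)
  qed
  moreover have "(h' \<circ> g) ` S = S'"
    using bij_betw_trans[OF g h'(1)] by (simp add: bij_betw_def)
  ultimately show ?thesis using that by blast
qed

text \<open>For \<open>S\<close> beyond \<open>w\<close>, the two inclusions say that the points
  used outside \<open>{1..w}\<close> are exactly those of \<open>S\<close>.\<close>

definition exact_factorizations ::
  "nat list \<Rightarrow> nat \<Rightarrow> nat perm \<Rightarrow> nat set \<Rightarrow> (nat \<times> nat) list set" where
  "exact_factorizations lam w p S =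
    {l \<in> mono_factorizations_type lam ({1..w} \<union> S) p. S \<subseteq> moved_points l}"

text \<open>Relabel the points of \<open>S\<close> increasingly by those of \<open>S'\<close> and
  keep \<open>{1..w}\<close>. Monotonicity preserves both the order of the larger points and the
  inequality inside each pair, and the product is unchanged because \<open>p\<close> fixes all
  points beyond \<open>w\<close>. Exchanging \<open>S\<close> and \<open>S'\<close> later yields
  equality.\<close>

lemma card_exact_factorizations_le:
  assumes p: "affected p \<subseteq> {1..w}" and S: "finite S" "S \<subseteq> {w<..}" and S': "finite S'" "S' \<subseteq> {w<..}"
    and "card S = card S'"
  shows "card (exact_factorizations lam w p S) \<le> card (exact_factorizations lam w p S')"
proof -
  obtain g where g: "strict_mono_on S g" "g ` S = S'"
    using ex_strict_mono_on_same_card[OF S(1) S'(1) assms(6)] by blast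
  define f where "f x = (if x \<le> w then x else g x)" for x
  define B where "B = {1..w} \<union> S"
  have f: "strict_mono_on B f"
  proof (rule strict_mono_onI)
    fix x y assume xy: "x \<in> B" "y \<in> B" "x < y"
    have "w < g y" if "w < y" using that xy S'(2) g(2) by (auto simp: B_def)
    then show "f x < f y" using xy g(1) by (auto simp: f_def B_def strict_mono_onD)
  qed
  then have inj: "inj_on f B" by (rule strict_mono_on_imp_inj_on)
  have fB: "f ` B = {1..w} \<union> S'"
  proof -
    have "f ` {1..w} = {1..w}" by (auto simp: f_def)
    moreover have "f ` S = S'" using g(2) S(2) by (force simp: f_def)
    ultimately show ?thesis by (simp add: B_def image_Un)
  qed
  have "finite (exact_factorizations lam w p S')"
    unfolding exact_factorizations_def using S' by (simp add: finite_mono_factorizations_type)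
  moreover have "map (map_prod f f) l \<in> exact_factorizations lam w p S'"
    if l: "l \<in> exact_factorizations lam w p S" for l
  proof -
    have l': "sorted (map snd l)" "moved_points l \<subseteq> B" "\<forall>(s, t)\<in>set l. s < t" "transp_prod l = p"
      "seq_type (map snd l) = lam" "S \<subseteq> moved_points l"
      using l by (auto simp: exact_factorizations_def mono_factorizations_type_def
          mono_factorizations_alt B_def)
    let ?l = "map (map_prod f f) l"
    have snd: "map snd ?l = map f (map snd l)" by simp
    have sub: "set (map snd l) \<subseteq> B" using l'(2) by (auto simp: moved_points_def)
    have "sorted (map snd ?l)"
      unfolding snd sorted_map[of f]
      by (rule sorted_wrt_mono_rel[OF _ l'(1)]) (use sub f in \<open>auto simp: strict_mono_on_leD subset_iff\<close>)
    moreover have mp: "moved_points ?l = f ` moved_points l"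
      by (force simp: moved_points_def)
    moreover have "\<forall>(s, t)\<in>set ?l. s < t"
      using l'(2,3) f by (fastforce simp: moved_points_subset_iff strict_mono_onD)
    moreover have "transp_prod ?l = p"
    proof (rule perm_eqI)
      fix y
      show "transp_prod ?l \<langle>$\<rangle> y = p \<langle>$\<rangle> y"
      proof (cases "y \<in> f ` B")
        case True
        then obtain x where x: "x \<in> B" "y = f x" by blast
        then have *: "transp_prod ?l \<langle>$\<rangle> y = f (p \<langle>$\<rangle> x)"
          using transp_prod_relabel[OF inj l'(2) x(1)] l'(4) by simp
        show ?thesis
        proof (cases "x \<le> w")
          case True
          then have "x \<in> {1..w}" using x S(2) by (auto simp: B_def)
          then have "p \<langle>$\<rangle> x \<in> {1..w}" using bij_betw_apply[OF p] by (auto simp: bij_betw_def)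
          then show ?thesis using * x True by (simp add: f_def)
        next
          case False
          then have "x \<notin> affected p" using p by auto
          moreover have "y \<notin> affected p"
          proof -
            have "y \<in> S'" using False x g(2) by (auto simp: f_def B_def)
            then show ?thesis using p S'(2)
              by (metis atLeastAtMost_iff greaterThan_iff not_le subsetD)
          qed
          ultimately show ?thesis using * x by (simp add: in_affected)
        qed
      next
        case False
        then have "y \<notin> affected p" using fB p by auto
        moreover have "y \<notin> moved_points ?l" using mp False l'(2) by auto
        ultimately show ?thesis by (simp add: transp_prod_apply_outside in_affected)
      qed
    qed
    moreover have "seq_type (map snd ?l) = lam"
      unfolding snd using seq_type_map_inj[OF inj_on_subset[OF inj sub]] l'(5) by simp
    moreover have "S' \<subseteq> f ` moved_points l"
    proof -
      have "f ` S = S'" using g(2) S(2) by (force simp: f_def)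
      then show ?thesis using l'(6) by blast
    qed
    moreover have "f ` moved_points l \<subseteq> {1..w} \<union> S'" using fB l'(2) by blast
    ultimately show ?thesis
      by (simp add: exact_factorizations_def mono_factorizations_type_def mono_factorizations_alt)
  qed
  moreover have "inj_on (map (map_prod f f)) (exact_factorizations lam w p S)"
  proof (rule inj_on_subset)
    show "inj_on (map (map_prod f f)) (lists (B \<times> B))"
      by (intro inj_on_mapI) (auto intro!: inj_on_subset[OF map_prod_inj_on[OF inj inj]])
    show "exact_factorizations lam w p S \<subseteq> lists (B \<times> B)"
      by (auto simp: exact_factorizations_def mono_factorizations_type_def mono_factorizations_def B_def)
  qed
  ultimately show ?thesis by (intro card_inj_on_le[of "map (map_prod f f)"]) auto
qed

lemma card_exact_factorizations:
  assumes "affected p \<subseteq> {1..w}" "finite S" "S \<subseteq> {w<..}"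
  shows "card (exact_factorizations lam w p S) =
    card (exact_factorizations lam w p {w<..w + card S})"
  using assms by (intro antisym card_exact_factorizations_le) auto

text \<open>A list of \<open>sum_list lam\<close> transpositions touches at most twice as many
  points.\<close>

lemma exact_factorizations_empty:
  assumes "card S > 2 * sum_list lam"
  shows "exact_factorizations lam w p S = {}"
proof -
  have False if "l \<in> exact_factorizations lam w p S" for l
  proof -
    have l: "length l = sum_list lam" "S \<subseteq> moved_points l"
      using that sum_list_seq_type[of "map snd l"]
      by (auto simp: exact_factorizations_def mono_factorizations_type_def)
    have "card S \<le> card (moved_points l)" using l(2) by (intro card_mono) (simp_all add: moved_points_def)
    also have "\<dots> \<le> card (fst ` set l) + card (snd ` set l)"
      unfolding moved_points_def by (rule card_Un_le)
    also have "\<dots> \<le> length l + length l"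
      by (intro add_mono) (metis card_length length_map set_map)+
    finally show False using l assms by simp
  qed
  then show ?thesis by blast
qed

lemma sum_Pow_card:
  fixes f :: "nat \<Rightarrow> nat"
  assumes "finite A"
  shows "(\<Sum>S\<in>Pow A. f (card S)) = (\<Sum>r\<le>card A. (card A choose r) * f r)"
proof -
  have "(\<Sum>S\<in>Pow A. f (card S)) = (\<Sum>r\<le>card A. \<Sum>S\<in>{S \<in> Pow A. card S = r}. f (card S))"
    using assms by (intro sum.group[symmetric]) (auto simp: card_mono)
  also have "\<dots> = (\<Sum>r\<le>card A. card {S. S \<subseteq> A \<and> card S = r} * f r)"
    by (intro sum.cong) (simp_all add: Pow_def)
  finally show ?thesis using assms by (simp add: n_subsets)
qed

text \<open>Sort the factorizations by the set of points they use beyond \<open>w\<close>. Only the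
  size of this set matters, so the sets of size \<open>r\<close> contribute a binomial coefficient
  times a number independent of \<open>n\<close>. The bound on \<open>r\<close> is also independent
  of \<open>n\<close>, which makes the sum polynomial.\<close>

lemma card_mono_factorizations_type_binomial:
  assumes p: "affected p \<subseteq> {1..w}" and "w \<le> n"
  shows "card (mono_factorizations_type lam {1..n} p) =
    (\<Sum>r\<le>2 * sum_list lam. (n - w choose r) * card (exact_factorizations lam w p {w<..w + r}))"
proof -
  define c where "c r = card (exact_factorizations lam w p {w<..w + r})" for r
  let ?M = "mono_factorizations_type lam {1..n} p"
  have "card ?M = (\<Sum>l\<in>?M. 1)" by simp
  also have "\<dots> = (\<Sum>S\<in>Pow {w<..n}. \<Sum>l\<in>{l \<in> ?M. moved_points l - {1..w} = S}. 1)"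
    by (rule sum.group[symmetric, OF finite_mono_factorizations_type])
      (auto simp: mono_factorizations_type_def mono_factorizations_alt)
  also have "\<dots> = (\<Sum>S\<in>Pow {w<..n}. c (card S))"
  proof (rule sum.cong)
    fix S assume S: "S \<in> Pow {w<..n}"
    then have "finite S" "S \<subseteq> {w<..}" by (auto intro: finite_subset)
    then have "c (card S) = card (exact_factorizations lam w p S)"
      unfolding c_def by (rule card_exact_factorizations[OF p, symmetric])
    moreover have "moved_points l \<subseteq> {1..n} \<and> moved_points l - {1..w} = S \<longleftrightarrow>
        moved_points l \<subseteq> {1..w} \<union> S \<and> S \<subseteq> moved_points l" for l
      using S assms(2) by (auto simp: subset_iff)
    then have "{l \<in> ?M. moved_points l - {1..w} = S} = exact_factorizations lam w p S"
      unfolding exact_factorizations_def mono_factorizations_type_def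
      by (intro set_eqI) (simp only: mem_Collect_eq mono_factorizations_alt, blast)
    ultimately show "(\<Sum>l\<in>{l \<in> ?M. moved_points l - {1..w} = S}. 1) = c (card S)" by simp
  qed simp
  also have "\<dots> = (\<Sum>r\<le>n - w. (n - w choose r) * c r)"
    by (subst sum_Pow_card) simp_all
  \<comment> \<open>Summands beyond \<open>n - w\<close> vanish through the binomial coefficient,
    those beyond \<open>2 * sum_list lam\<close> through the other factor. The larger of the two
    bounds mediates between them.\<close>
  also have "\<dots> = (\<Sum>r\<le>max (n - w) (2 * sum_list lam). (n - w choose r) * c r)"
    by (rule sum.mono_neutral_left) (auto simp: binomial_eq_0)
  also have "\<dots> = (\<Sum>r\<le>2 * sum_list lam. (n - w choose r) * c r)"
    by (rule sum.mono_neutral_right) (auto simp: c_def exact_factorizations_empty)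
  finally show ?thesis by (simp add: c_def)
qed

text \<open>For \<open>n \<ge> w\<close> the subtraction is exact, so the binomial coefficient is a
  product of \<open>r\<close> linear factors in \<open>n\<close> divided by
  \<open>fact r\<close>.\<close>

lemma ex_binomial_poly:
  "\<exists>P :: complex poly. \<forall>n\<ge>w. poly P (of_nat n) = of_nat (n - w choose r)"
proof (intro exI allI impI)
  fix n assume "w \<le> n"
  then have "of_nat (n - w choose r) = (\<Prod>i\<in>{0..<r}. of_nat n - of_nat (w + i)) / (fact r :: complex)"
    by (simp add: binomial_gbinomial gbinomial_prod_rev of_nat_diff diff_diff_eq)
  then show "poly (smult (1 / fact r) (\<Prod>i\<in>{0..<r}. [:- of_nat (w + i), 1:])) (of_nat n) =
      (of_nat (n - w choose r) :: complex)"
    by (simp add: poly_prod algebra_simps)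
qed

lemma ex_poly_card_mono_factorizations_type:
  assumes "affected p \<subseteq> {1..w}"
  shows "\<exists>P :: complex poly. \<forall>n\<ge>w. poly P (of_nat n) =
    of_nat (card (mono_factorizations_type lam {1..n} p))"
proof -
  obtain P :: "nat \<Rightarrow> complex poly" where
    P: "\<And>r n. w \<le> n \<Longrightarrow> poly (P r) (of_nat n) = of_nat (n - w choose r)"
    using ex_binomial_poly by metis
  show ?thesis
    by (rule exI[of _ "\<Sum>r\<le>2 * sum_list lam.
          smult (of_nat (card (exact_factorizations lam w p {w<..w + r}))) (P r)"])
      (use card_mono_factorizations_type_binomial[OF assms] in \<open>simp add: poly_sum P mult.commute\<close>)
qed

section \<open>Cycle types and conjugacy\<close>

text \<open>The cycle \<open>(a, a + 1, \<dots>, a + k)\<close>, and the product of such cycles on consecutive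
  intervals of lengths \<open>k + 1\<close> for \<open>k\<close> in \<open>c\<close>.\<close>

primrec interval_cycle :: "nat \<Rightarrow> nat \<Rightarrow> nat perm" where
  "interval_cycle a 0 = 1"
| "interval_cycle a (Suc k) = interval_cycle a k * \<langle>a + k \<leftrightarrow> a + Suc k\<rangle>"

primrec block_perm :: "nat \<Rightarrow> nat list \<Rightarrow> nat perm" where
  "block_perm a [] = 1"
| "block_perm a (k # c) = interval_cycle a k * block_perm (Suc (a + k)) c"

lemma interval_cycle_apply:
  "interval_cycle a k \<langle>$\<rangle> x = (if a \<le> x \<and> x < a + k then Suc x else if x = a + k then a else x)"
proof (induction k arbitrary: x)
  case (Suc k)
  consider "x = a + k" | "x = Suc (a + k)" | "x \<noteq> a + k" "x \<noteq> Suc (a + k)" by blast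
  then show ?case by cases (auto simp: apply_times Suc)
qed auto

lemma wt_Nil [simp]: "wt [] = 0" and wt_Cons [simp]: "wt (k # c) = Suc (k + wt c)"
  and wt_append [simp]: "wt (c @ c') = wt c + wt c'"
  and wt_replicate_0 [simp]: "wt (replicate r 0) = r"
  by (simp_all add: wt_def sum_list_replicate)

lemma affected_interval_cycle: "affected (interval_cycle a k) \<subseteq> {a..a + k}"
  by (auto simp: in_affected interval_cycle_apply split: if_splits)

lemma affected_block_perm: "affected (block_perm a c) \<subseteq> {a..<a + wt c}"
proof (induction c arbitrary: a)
  case (Cons k c)
  have "affected (block_perm (Suc (a + k)) c) \<subseteq> {Suc (a + k)..<Suc (a + k) + wt c}" by (rule Cons)
  moreover note affected_interval_cycle[of a k]
    affected_times[of "interval_cycle a k" "block_perm (Suc (a + k)) c"]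
  ultimately have "affected (block_perm a (k # c)) \<subseteq> {a..a + k} \<union> {Suc (a + k)..<Suc (a + k) + wt c}"
    by fastforce
  also have "\<dots> \<subseteq> {a..<a + wt (k # c)}" by auto
  finally show ?case .
qed simp

lemma block_perm_Cons_apply_le:
  assumes "x \<le> a + k"
  shows "block_perm a (k # c) \<langle>$\<rangle> x = interval_cycle a k \<langle>$\<rangle> x"
proof -
  have "x \<notin> affected (block_perm (Suc (a + k)) c)"
    using affected_block_perm[of "Suc (a + k)" c] assms by fastforce
  then show ?thesis by (simp add: apply_times in_affected)
qed

lemma block_perm_Cons_apply_gt:
  assumes "a + k < x"
  shows "block_perm a (k # c) \<langle>$\<rangle> x = block_perm (Suc (a + k)) c \<langle>$\<rangle> x"
    "a + k < block_perm (Suc (a + k)) c \<langle>$\<rangle> x"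
proof -
  show *: "a + k < block_perm (Suc (a + k)) c \<langle>$\<rangle> x"
  proof (cases "x \<in> affected (block_perm (Suc (a + k)) c)")
    case True
    then have "block_perm (Suc (a + k)) c \<langle>$\<rangle> x \<in> affected (block_perm (Suc (a + k)) c)" by simp
    then show ?thesis using affected_block_perm[of "Suc (a + k)" c] by fastforce
  next
    case False
    then show ?thesis using assms by (simp add: in_affected)
  qed
  then show "block_perm a (k # c) \<langle>$\<rangle> x = block_perm (Suc (a + k)) c \<langle>$\<rangle> x"
    by (simp add: apply_times interval_cycle_apply)
qed

text \<open>A zero entry is a one-point block. Padding with zeros lets the blocks exhaust
  \<open>{1..n}\<close> without changing the permutation.\<close>

lemma block_perm_append_zeros: "block_perm a (c @ replicate r 0) = block_perm a c"
proof (induction c arbitrary: a)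
  case Nil
  show ?case by (induction r arbitrary: a) simp_all
qed simp

section \<open>Orbits of block permutations and reduced cycle types\<close>

lemma orbit_subset:
  assumes "\<And>x. x \<in> A \<Longrightarrow> p \<langle>$\<rangle> x \<in> A" "x \<in> A"
  shows "orbit p x \<subseteq> A"
proof -
  have "(p ^ j) \<langle>$\<rangle> x \<in> A" for j
    using assms by (induction j) (auto simp: apply_times)
  then show ?thesis by (auto simp: orbit_def)
qed

lemma orbit_cong:
  assumes "\<And>x. x \<in> A \<Longrightarrow> p \<langle>$\<rangle> x = q \<langle>$\<rangle> x" "\<And>x. x \<in> A \<Longrightarrow> q \<langle>$\<rangle> x \<in> A" "x \<in> A"
  shows "orbit p x = orbit q x"
proof -
  have "(p ^ j) \<langle>$\<rangle> x = (q ^ j) \<langle>$\<rangle> x \<and> (q ^ j) \<langle>$\<rangle> x \<in> A" for j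
    using assms by (induction j) (auto simp: apply_times)
  then show ?thesis by (simp add: orbit_def)
qed

lemma orbit_interval_cycle:
  assumes "x \<in> {a..a + k}"
  shows "orbit (interval_cycle a k) x = {a..a + k}"
proof -
  let ?p = "interval_cycle a k"
  have pow: "j \<le> k \<Longrightarrow> (?p ^ j) \<langle>$\<rangle> a = a + j" for j
    by (induction j) (auto simp: apply_times interval_cycle_apply)
  have "{a..a + k} \<subseteq> orbit ?p a"
  proof
    fix y assume "y \<in> {a..a + k}"
    then have "y - a \<le> k" "a + (y - a) = y" by auto
    then have "(?p ^ (y - a)) \<langle>$\<rangle> a = y" using pow[of "y - a"] by metis
    then show "y \<in> orbit ?p a" by (rule in_orbitI)
  qed
  moreover have "orbit ?p a \<subseteq> {a..a + k}"
    by (rule orbit_subset) (auto simp: interval_cycle_apply)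
  ultimately show ?thesis using assms orbit_equiv[of x ?p a] by blast
qed

lemma orbit_subset_affected:
  assumes "affected p \<subseteq> A" "x \<in> A"
  shows "orbit p x \<subseteq> A"
  using bij_betw_apply[OF assms(1)] assms(2) by (intro orbit_subset) (auto simp: bij_betw_def)

text \<open>Every block is one orbit. The first block differs from all later orbits because these
  lie in the remaining interval, so it contributes one new entry to the multiset.\<close>

lemma mset_orbits_block_perm:
  "image_mset card (mset_set (orbit (block_perm a c) ` {a..<a + wt c})) = mset (map Suc c)"
proof (induction c arbitrary: a)
  case (Cons k c)
  define B where "B = {Suc (a + k)..<Suc (a + k) + wt c}"
  let ?p = "block_perm a (k # c)" and ?q = "block_perm (Suc (a + k)) c"
  have A: "{a..<a + wt (k # c)} = {a..a + k} \<union> B" by (auto simp: B_def)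
  have "orbit ?p x = {a..a + k}" if x: "x \<in> {a..a + k}" for x
  proof -
    have "orbit ?p x = orbit (interval_cycle a k) x"
      using x by (intro orbit_cong[where A = "{a..a + k}"])
        (auto simp: block_perm_Cons_apply_le interval_cycle_apply simp del: block_perm.simps)
    then show ?thesis using orbit_interval_cycle[OF x] by simp
  qed
  then have "orbit ?p ` {a..a + k} = (\<lambda>_. {a..a + k}) ` {a..a + k}" by (rule image_cong[OF refl])
  then have 1: "orbit ?p ` {a..a + k} = {{a..a + k}}" by (simp only: image_constant_conv) simp
  have "orbit ?p x = orbit ?q x" if "x \<in> B" for x
    using that block_perm_Cons_apply_gt[of a k] by (intro orbit_cong[where A = "{a + k<..}"])
      (auto simp: B_def simp del: block_perm.simps)
  then have 2: "orbit ?p ` B = orbit ?q ` B" by auto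
  have "{a..a + k} \<notin> orbit ?q ` B"
  proof
    assume "{a..a + k} \<in> orbit ?q ` B"
    then have "{a..a + k} \<subseteq> B" using orbit_subset_affected[of ?q B] affected_block_perm
      unfolding B_def by blast
    then have "a \<in> B" by (rule subsetD) simp
    then show False by (simp add: B_def)
  qed
  moreover have "image_mset card (mset_set (orbit ?q ` B)) = mset (map Suc c)"
    unfolding B_def by (rule Cons)
  ultimately show ?case unfolding A image_Un 1 2 by (simp add: B_def)
qed simp

lemma rev_sorted_list_of_multiset_mset:
  "sorted_wrt (\<ge>) (c :: nat list) \<Longrightarrow> rev (sorted_list_of_multiset (mset c)) = c"
  by (simp add: sorted_list_of_multiset_mset sort_desc_id flip: sort_desc_def)

lemma mset_orbits_partition_perm:
  assumes "is_partition \<mu>" "wt \<mu> \<le> n"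
  shows "image_mset card (mset_set (orbit (block_perm 1 \<mu>) ` {1..n})) =
    mset (map Suc (\<mu> @ replicate (n - wt \<mu>) 0))"
proof -
  let ?c = "\<mu> @ replicate (n - wt \<mu>) 0"
  have "{1..n} = {1..<1 + wt ?c}" using assms by auto
  then show ?thesis
    using mset_orbits_block_perm[of 1 ?c] by (simp only: block_perm_append_zeros)
qed

lemma reduced_cycle_type_block_perm:
  assumes "is_partition \<mu>" "wt \<mu> \<le> n"
  shows "reduced_cycle_type n (block_perm 1 \<mu>) = \<mu>"
proof -
  let ?c = "\<mu> @ replicate (n - wt \<mu>) 0"
  have "sorted_wrt (\<ge>) (replicate r (x :: nat))" for r x by (induction r) auto
  then have "sorted_wrt (\<ge>) (map Suc ?c)"
    using assms by (auto simp: is_partition_def sorted_wrt_map sorted_wrt_append)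
  then have "cycle_type n (block_perm 1 \<mu>) = map Suc ?c"
    unfolding cycle_type_def mset_orbits_partition_perm[OF assms]
    by (rule rev_sorted_list_of_multiset_mset)
  moreover have "filter (\<lambda>k. k \<noteq> 0) \<mu> = \<mu>"
    using assms by (auto simp: is_partition_def filter_id_conv)
  ultimately show ?thesis by (simp add: reduced_cycle_type_def comp_def filter_empty_conv)
qed

lemma block_perm_in_Sym_group: "wt \<mu> \<le> n \<Longrightarrow> block_perm 1 \<mu> \<in> Sym_group n"
  using affected_block_perm[of 1 \<mu>] by (fastforce simp: Sym_group_def)

lemma is_partition_reduced_cycle_type: "is_partition (reduced_cycle_type n p)"
proof -
  have "sorted_wrt (\<ge>) (cycle_type n p)"
    by (simp add: cycle_type_def sorted_wrt_rev)
  then have "sorted_wrt (\<ge>) (map (\<lambda>k. k - 1) (cycle_type n p))"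
    unfolding sorted_wrt_map by (rule sorted_wrt_mono_rel[rotated]) auto
  then show ?thesis
    by (auto simp: is_partition_def reduced_cycle_type_def intro: sorted_wrt_filter)
qed

lemma mset_cycle_type:
  "mset (cycle_type n p) = image_mset card (mset_set (orbit p ` {1..n}))"
  by (simp add: cycle_type_def)

lemma sum_list_cycle_type:
  assumes "p \<in> Sym_group n"
  shows "sum_list (cycle_type n p) = n"
proof -
  have p: "affected p \<subseteq> {1..n}" using assms by (simp add: Sym_group_def)
  have "sum_list (cycle_type n p) = (\<Sum>S\<in>orbit p ` {1..n}. card S)"
    by (metis mset_cycle_type sum_mset_sum_list sum_unfold_sum_mset)
  also have "\<dots> = card (\<Union> (orbit p ` {1..n}))"
  proof (rule card_Union_disjoint[symmetric])
    show "pairwise disjnt (orbit p ` {1..n})"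
      unfolding pairwise_def disjnt_def using orbit_disjoint[of p] by blast
  qed auto
  also have "\<Union> (orbit p ` {1..n}) = {1..n}"
    using orbit_subset_affected[OF p] in_orbit_self[of _ p] by blast
  finally show ?thesis by simp
qed

lemma cycle_type_pos: "k \<in> set (cycle_type n p) \<Longrightarrow> 0 < k"
proof -
  assume "k \<in> set (cycle_type n p)"
  then have "k \<in># mset (cycle_type n p)" by simp
  then show "0 < k" unfolding mset_cycle_type by auto
qed

text \<open>Reduction of a cycle type loses only the parts equal to 1; they are restored as
  successors of zeros.\<close>

lemma mset_shifted_positive:
  assumes "\<forall>k\<in>set L. 0 < (k::nat)"
  shows "mset L = mset (map Suc (filter (\<lambda>k. k \<noteq> 0) (map (\<lambda>k. k - 1) L) @
      replicate (length (filter ((=) 1) L)) 0))"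
    and "sum_list L = wt (filter (\<lambda>k. k \<noteq> 0) (map (\<lambda>k. k - 1) L)) + length (filter ((=) 1) L)"
  using assms by (induction L) auto

text \<open>The weight of the reduced cycle type is the number of points moved by \<open>p\<close>,
  so the difference to \<open>n\<close> counts the fixed points.\<close>

lemma wt_reduced_cycle_type_le:
  assumes "p \<in> Sym_group n"
  shows "wt (reduced_cycle_type n p) \<le> n"
    and "mset (cycle_type n p) = mset (map Suc
      (reduced_cycle_type n p @ replicate (n - wt (reduced_cycle_type n p)) 0))"
proof -
  have pos: "\<forall>k\<in>set (cycle_type n p). 0 < k" using cycle_type_pos by blast
  have sum: "n = wt (reduced_cycle_type n p) + length (filter ((=) 1) (cycle_type n p))"
    using mset_shifted_positive(2)[OF pos] sum_list_cycle_type[OF assms]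
    by (simp add: reduced_cycle_type_def)
  then show "wt (reduced_cycle_type n p) \<le> n" by linarith
  have "n - wt (reduced_cycle_type n p) = length (filter ((=) 1) (cycle_type n p))" using sum by linarith
  then show "mset (cycle_type n p) = mset (map Suc
      (reduced_cycle_type n p @ replicate (n - wt (reduced_cycle_type n p)) 0))"
    using mset_shifted_positive(1)[OF pos] by (simp only: reduced_cycle_type_def)
qed

section \<open>Conjugacy of permutations with the same orbit sizes\<close>

lemma ex_bij_betw_of_image_mset_eq:
  assumes "finite X" "finite Y" "image_mset f (mset_set X) = image_mset g (mset_set Y)"
  shows "\<exists>h. bij_betw h X Y \<and> (\<forall>x\<in>X. g (h x) = f x)"
  using assms
proof (induction X arbitrary: Y rule: finite_induct)
  case empty
  then have "Y = {}" by (simp add: mset_set_empty_iff)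
  then show ?case by (simp add: bij_betw_def)
next
  case (insert x X)
  have "f x \<in># image_mset g (mset_set Y)"
    by (simp flip: insert.prems(2) add: insert.hyps)
  then obtain y where y: "y \<in> Y" "g y = f x" using insert.prems(1) by auto
  then have "mset_set Y = add_mset y (mset_set (Y - {y}))"
    using insert.prems(1) by (simp add: mset_set.remove)
  then have "image_mset f (mset_set X) = image_mset g (mset_set (Y - {y}))"
    using insert.prems(2) insert.hyps y by simp
  then obtain h where h: "bij_betw h X (Y - {y})" "\<forall>x\<in>X. g (h x) = f x"
    using insert.IH[of "Y - {y}"] insert.prems(1) by auto
  have "bij_betw (h(x := y)) X (Y - {y})"
    using h(1) insert.hyps(2) by (subst bij_betw_cong[where g = h]) auto
  then have "bij_betw (h(x := y)) (insert x X) (insert y (Y - {y}))"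
    using notIn_Un_bij_betw[of x X "h(x := y)" "Y - {y}"] insert.hyps(2) by simp
  then have "bij_betw (h(x := y)) (insert x X) Y" using y(1) by (simp add: insert_absorb)
  moreover have "\<forall>z\<in>insert x X. g ((h(x := y)) z) = f z" using h(2) y(2) by auto
  ultimately show ?case by blast
qed

lemma ex_perm_apply_eq:
  assumes "finite A" "bij_betw f A A" "\<And>x. x \<notin> A \<Longrightarrow> f x = x"
  obtains p where "Perm.apply p = f" "affected p \<subseteq> A"
proof -
  have "bij_betw f (- A) (- A)" using assms(3) by (subst bij_betw_cong[where g = id]) auto
  then have "bij f" using bij_betw_combine[OF assms(2), of "- A" "- A"] by simp
  moreover have fin: "{a. f a \<noteq> a} \<subseteq> A" using assms(3) by blast
  ultimately have "Perm.apply (Perm f) = f"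
    using assms(1) by (intro Perm_inverse) (auto intro: finite_subset)
  moreover from this have "affected (Perm f) \<subseteq> A" using fin by (auto simp: in_affected)
  ultimately show ?thesis using that by blast
qed

text \<open>Match the orbits of \<open>p\<close> with orbits of \<open>q\<close> of the same size,
  choose a base point in each, and send the j-th iterate of one base point under \<open>p\<close> to
  the j-th iterate of the matching one under \<open>q\<close>.\<close>

lemma conjugate_of_orbit_cards_eq:
  assumes p: "affected p \<subseteq> A" and q: "affected q \<subseteq> A" and A: "finite A"
    and eq: "image_mset card (mset_set (orbit p ` A)) = image_mset card (mset_set (orbit q ` A))"
  shows "\<exists>\<sigma>. affected \<sigma> \<subseteq> A \<and> \<sigma> * p = q * \<sigma>"
proof -
  obtain h where h: "bij_betw h (orbit p ` A) (orbit q ` A)"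
      "\<forall>S\<in>orbit p ` A. card (h S) = card S"
    using ex_bij_betw_of_image_mset_eq[OF _ _ eq] A by auto
  \<comment> \<open>The base points \<open>r x\<close> and \<open>r' x\<close> depend only on the
    orbit of \<open>x\<close>. The exponent \<open>j x\<close> is an arbitrary choice, determined
    only modulo the size of the orbit.\<close>
  define r where "r x = (SOME y. y \<in> orbit p x)" for x
  define r' where "r' x = (SOME y. y \<in> h (orbit p x))" for x
  define j where "j x = (SOME j. (p ^ j) \<langle>$\<rangle> (r x) = x)" for x
  define f where "f x = (if x \<in> A then (q ^ j x) \<langle>$\<rangle> (r' x) else x)" for x
  have "\<exists>y. y \<in> orbit p x" for x by (rule exI[of _ x]) simp
  then have r: "r x \<in> orbit p x" for x unfolding r_def by (rule someI_ex)
  then have orb_r: "orbit p (r x) = orbit p x" for x by (rule orbit_equiv)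
  have j: "(p ^ j x) \<langle>$\<rangle> (r x) = x" for x
  proof -
    have "x \<in> orbit p (r x)" by (simp add: orb_r)
    then have "\<exists>j. (p ^ j) \<langle>$\<rangle> (r x) = x" by (metis in_orbitE)
    then show ?thesis unfolding j_def by (rule someI_ex)
  qed
  have hO: "h (orbit p x) \<in> orbit q ` A" if "x \<in> A" for x
    using h(1) that by (auto simp: bij_betw_def)
  have orb_r': "orbit q (r' x) = h (orbit p x)" if x: "x \<in> A" for x
  proof -
    obtain z where z: "h (orbit p x) = orbit q z" using hO[OF x] by blast
    then have "\<exists>y. y \<in> h (orbit p x)" using in_orbit_self[of z q] by metis
    then have "r' x \<in> h (orbit p x)" unfolding r'_def by (rule someI_ex)
    then show ?thesis using z orbit_equiv by metis
  qed
  \<comment> \<open>With equal orders, two powers of \<open>p\<close> agree at \<open>r x\<close>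
    exactly if the same powers of \<open>q\<close> agree at \<open>r' x\<close>. This yields both
    the injectivity of \<open>f\<close> and the intertwining relation.\<close>
  have ord: "Perm.order q (r' x) = Perm.order p (r x)" if "x \<in> A" for x
    using that h(2) by (simp add: orb_r orb_r' flip: card_orbit_eq)
  have orb_f: "orbit q (f x) = h (orbit p x)" if "x \<in> A" for x
    using that by (simp add: f_def orb_r')
  have pA: "p \<langle>$\<rangle> x \<in> A" if "x \<in> A" for x using bij_betw_apply[OF p] that by (auto simp: bij_betw_def)
  have inj: "inj_on f A"
  proof (rule inj_onI)
    fix x y assume xy: "x \<in> A" "y \<in> A" "f x = f y"
    then have "h (orbit p x) = h (orbit p y)" using orb_f by metis
    then have O: "orbit p x = orbit p y" using h(1) xy by (auto simp: bij_betw_def inj_on_def)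
    then have r_eq: "r x = r y" "r' x = r' y" by (simp_all add: r_def r'_def)
    have "(q ^ j x) \<langle>$\<rangle> (r' x) = (q ^ j y) \<langle>$\<rangle> (r' x)" using xy r_eq by (simp add: f_def)
    then have "(p ^ j x) \<langle>$\<rangle> (r x) = (p ^ j y) \<langle>$\<rangle> (r x)"
      unfolding apply_power_eq_iff ord[OF xy(1)] .
    then show "x = y" using j r_eq by metis
  qed
  have "f x \<in> A" if x: "x \<in> A" for x
  proof -
    obtain z where "z \<in> A" "h (orbit p x) = orbit q z" using hO[OF x] by blast
    then have "h (orbit p x) \<subseteq> A" using orbit_subset_affected[OF q] by simp
    then show ?thesis using orb_f[OF x] in_orbit_self[of "f x" q] by blast
  qed
  then have "bij_betw f A A" using endo_inj_surj[OF A _ inj] inj by (auto simp: bij_betw_def)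
  then obtain \<sigma> where \<sigma>: "Perm.apply \<sigma> = f" "affected \<sigma> \<subseteq> A"
    using ex_perm_apply_eq[OF A, of f] by (auto simp: f_def)
  have "\<sigma> * p = q * \<sigma>"
  proof (rule perm_eqI)
    fix x
    have "f (p \<langle>$\<rangle> x) = q \<langle>$\<rangle> (f x)"
    proof (cases "x \<in> A")
      case True
      have "r (p \<langle>$\<rangle> x) = r x" "r' (p \<langle>$\<rangle> x) = r' x" by (simp_all add: r_def r'_def)
      then have "(p ^ j (p \<langle>$\<rangle> x)) \<langle>$\<rangle> (r x) = (p ^ Suc (j x)) \<langle>$\<rangle> (r x)"
        using j[of x] j[of "p \<langle>$\<rangle> x"] by (simp add: apply_times)
      then have "(q ^ j (p \<langle>$\<rangle> x)) \<langle>$\<rangle> (r' x) = (q ^ Suc (j x)) \<langle>$\<rangle> (r' x)"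
        unfolding apply_power_eq_iff ord[OF True] .
      then show ?thesis using True pA \<open>r' (p \<langle>$\<rangle> x) = r' x\<close> by (simp add: f_def apply_times)
    next
      case False
      then have "p \<langle>$\<rangle> x = x" "q \<langle>$\<rangle> x = x" using p q by (auto simp: in_affected)
      then show ?thesis using False by (simp add: f_def)
    qed
    then show "(\<sigma> * p) \<langle>$\<rangle> x = (q * \<sigma>) \<langle>$\<rangle> x" by (simp add: apply_times \<sigma>(1))
  qed
  with \<sigma>(2) show ?thesis by blast
qed

lemma conjugate_block_perm_reduced_cycle_type:
  assumes "p \<in> Sym_group n"
  shows "\<exists>\<sigma>\<in>Sym_group n. \<sigma> * p = block_perm 1 (reduced_cycle_type n p) * \<sigma>"
proof -
  let ?\<mu> = "reduced_cycle_type n p"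
  have "image_mset card (mset_set (orbit p ` {1..n})) =
    image_mset card (mset_set (orbit (block_perm 1 ?\<mu>) ` {1..n}))"
    using wt_reduced_cycle_type_le[OF assms] mset_cycle_type[of n p]
      mset_orbits_partition_perm[OF is_partition_reduced_cycle_type, of n p n] by simp
  then show ?thesis
    using conjugate_of_orbit_cards_eq[of p "{1..n}" "block_perm 1 ?\<mu>"] assms
      block_perm_in_Sym_group[OF wt_reduced_cycle_type_le(1)[OF assms]]
    by (auto simp: Sym_group_def)
qed

section \<open>Existence and uniqueness of the coefficient polynomials\<close>

lemma finite_partitions_wt_le: "finite {\<mu>. is_partition \<mu> \<and> wt \<mu> \<le> n}"
proof (rule finite_subset)
  show "{\<mu>. is_partition \<mu> \<and> wt \<mu> \<le> n} \<subseteq> {xs. set xs \<subseteq> {..n} \<and> length xs \<le> n}"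
  proof clarify
    fix \<mu> assume \<mu>: "wt \<mu> \<le> n"
    have "x \<le> n" if "x \<in> set \<mu>" for x
      using member_le_sum_list[OF that] \<mu> by (simp add: wt_def)
    then show "set \<mu> \<subseteq> {..n} \<and> length \<mu> \<le> n" using \<mu> by (auto simp: wt_def)
  qed
qed (simp add: finite_lists_length_le)

lemma finite_Sym_group: "finite (Sym_group n)"
proof (rule inj_on_finite)
  let ?f = "\<lambda>p x. if x \<in> {1..n} then p \<langle>$\<rangle> x else 0"
  show "inj_on ?f (Sym_group n)"
  proof (rule inj_onI, rule perm_eqI)
    fix p q x assume *: "p \<in> Sym_group n" "q \<in> Sym_group n" "?f p = ?f q"
    show "p \<langle>$\<rangle> x = q \<langle>$\<rangle> x"
    proof (cases "x \<in> {1..n}")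
      case True
      then show ?thesis using fun_cong[OF *(3), of x] by simp
    next
      case False
      then have "x \<notin> affected p" "x \<notin> affected q" using *(1,2) unfolding Sym_group_def by blast+
      then show ?thesis by (simp add: in_affected)
    qed
  qed
  show "?f ` Sym_group n \<subseteq> {f. \<forall>x. (x \<in> {1..n} \<longrightarrow> f x \<in> {1..n}) \<and> (x \<notin> {1..n} \<longrightarrow> f x = 0)}"
  proof clarify
    fix p x assume "p \<in> Sym_group n"
    then have "bij_betw (Perm.apply p) {1..n} {1..n}" by (intro bij_betw_apply) (simp add: Sym_group_def)
    then show "(x \<in> {1..n} \<longrightarrow> ?f p x \<in> {1..n}) \<and> (x \<notin> {1..n} \<longrightarrow> ?f p x = 0)"
      by (auto simp: bij_betw_def)
  qed
  show "finite {f :: nat \<Rightarrow> nat. \<forall>x. (x \<in> {1..n} \<longrightarrow> f x \<in> {1..n}) \<and> (x \<notin> {1..n} \<longrightarrow> f x = 0)}"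
    by (rule finite_set_of_finite_funs) simp_all
qed

lemma lookup_class_sum:
  "Poly_Mapping.lookup (class_sum \<mu> n) p =
    (if p \<in> Sym_group n \<and> reduced_cycle_type n p = \<mu> then 1 else 0)"
proof -
  have "finite {p \<in> Sym_group n. reduced_cycle_type n p = \<mu>}" by (simp add: finite_Sym_group)
  then show ?thesis by (simp add: class_sum_def lookup_sum lookup_perm_elem)
qed

lemma lookup_class_expansion:
  "Poly_Mapping.lookup (\<Sum>\<mu> | is_partition \<mu> \<and> wt \<mu> \<le> n. scalar (c \<mu>) * class_sum \<mu> n) p =
    (if p \<in> Sym_group n then c (reduced_cycle_type n p) else 0)"
proof -
  have "Poly_Mapping.lookup (\<Sum>\<mu> | is_partition \<mu> \<and> wt \<mu> \<le> n. scalar (c \<mu>) * class_sum \<mu> n) p =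
    (\<Sum>\<mu> | is_partition \<mu> \<and> wt \<mu> \<le> n.
      if reduced_cycle_type n p = \<mu> then if p \<in> Sym_group n then c \<mu> else 0 else 0)"
    unfolding lookup_sum lookup_scalar_mult lookup_class_sum by (intro sum.cong) auto
  also have "\<dots> = (if p \<in> Sym_group n then c (reduced_cycle_type n p) else 0)"
    using wt_reduced_cycle_type_le(1)[of p n]
    by (auto simp: finite_partitions_wt_le is_partition_reduced_cycle_type)
  finally show ?thesis .
qed

text \<open>Inside the group, conjugacy replaces \<open>p\<close> by its standard representative.
  Outside, there are no factorizations, since those over \<open>{1..n}\<close> affect only these
  points.\<close>

lemma lookup_eval_monomial_sym_reduced_cycle_type:
  "Poly_Mapping.lookup (eval_Xi (monomial_sym lam) n) p = (if p \<in> Sym_group n then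
    of_nat (card (mono_factorizations_type lam {1..n} (block_perm 1 (reduced_cycle_type n p)))) else 0)"
proof (cases "p \<in> Sym_group n")
  case True
  then obtain \<sigma> where "\<sigma> \<in> Sym_group n" "\<sigma> * p = block_perm 1 (reduced_cycle_type n p) * \<sigma>"
    using conjugate_block_perm_reduced_cycle_type by blast
  then have "Poly_Mapping.lookup (eval_Xi (monomial_sym lam) n) p =
      Poly_Mapping.lookup (eval_Xi (monomial_sym lam) n) (block_perm 1 (reduced_cycle_type n p))"
    by (rule lookup_eval_monomial_sym_conj)
  then show ?thesis using True by (simp add: lookup_eval_monomial_sym)
next
  case False
  have "mono_factorizations_type lam {1..n} p = {}"
  proof -
    have "p \<in> Sym_group n" if "l \<in> mono_factorizations_type lam {1..n} p" for l
      using that affected_transp_prod[of l]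
      by (auto simp: mono_factorizations_type_def mono_factorizations_alt Sym_group_def)
    then show ?thesis using False by blast
  qed
  then show ?thesis using False by (simp add: lookup_eval_monomial_sym)
qed

lemma poly_eq_of_nat_values:
  fixes P Q :: "complex poly"
  assumes "\<And>n. N \<le> n \<Longrightarrow> poly P (of_nat n) = poly Q (of_nat n)"
  shows "P = Q"
proof (rule poly_eqI_degree)
  let ?A = "of_nat ` {N..N + max (degree P) (degree Q)} :: complex set"
  show "poly P x = poly Q x" if "x \<in> ?A" for x using that assms by auto
  have "card ?A = Suc (max (degree P) (degree Q))"
    by (subst card_image) (auto simp: inj_on_def)
  then show "card ?A > degree P" "card ?A > degree Q" by auto
qed

text \<open>Resolves the definite description in \<open>class_poly\<close>. Existence is the
  polynomial dependence of the counts on \<open>n\<close>; for uniqueness, the coefficient at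
  \<open>block_perm 1 \<mu>\<close> fixes the value of the polynomial at all large integers.\<close>

lemma poly_class_poly_monomial_sym:
  assumes "is_partition \<mu>" "wt \<mu> \<le> n" "1 \<le> n"
  shows "poly (class_poly (monomial_sym lam) \<mu>) (of_nat n) =
    of_nat (card (mono_factorizations_type lam {1..n} (block_perm 1 \<mu>)))"
proof -
  define N where "N \<mu> n = card (mono_factorizations_type lam {1..n} (block_perm 1 \<mu>))" for \<mu> n
  define Q where "Q G \<longleftrightarrow> (\<forall>\<mu>. \<not> is_partition \<mu> \<longrightarrow> G \<mu> = 0) \<and>
    (\<forall>n\<ge>1. eval_Xi (monomial_sym lam) n =
      (\<Sum>\<mu> | is_partition \<mu> \<and> wt \<mu> \<le> n. scalar (poly (G \<mu>) (of_nat n)) * class_sum \<mu> n))" for G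
  have "\<exists>P :: complex poly. \<forall>n\<ge>wt \<mu>. poly P (of_nat n) = of_nat (N \<mu> n)" for \<mu>
    unfolding N_def using affected_block_perm[of 1 \<mu>]
    by (intro ex_poly_card_mono_factorizations_type) fastforce
  then obtain P :: "nat list \<Rightarrow> complex poly" where
    P: "wt \<mu> \<le> n \<Longrightarrow> poly (P \<mu>) (of_nat n) = of_nat (N \<mu> n)" for \<mu> n by metis
  define G where "G \<mu> = (if is_partition \<mu> then P \<mu> else 0)" for \<mu>
  have "Q G" unfolding Q_def
  proof (intro conjI allI impI poly_mapping_eqI)
    fix n p
    show "Poly_Mapping.lookup (eval_Xi (monomial_sym lam) n) p = Poly_Mapping.lookup
      (\<Sum>\<mu> | is_partition \<mu> \<and> wt \<mu> \<le> n. scalar (poly (G \<mu>) (of_nat n)) * class_sum \<mu> n) p"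
      unfolding lookup_class_expansion lookup_eval_monomial_sym_reduced_cycle_type
      by (simp add: G_def is_partition_reduced_cycle_type P wt_reduced_cycle_type_le N_def)
  qed (simp add: G_def)
  moreover have "G' = G" if "Q G'" for G'
  proof
    fix \<mu>
    show "G' \<mu> = G \<mu>"
    proof (cases "is_partition \<mu>")
      case False
      then show ?thesis using that by (simp add: Q_def G_def)
    next
      case True
      show ?thesis
      proof (rule poly_eq_of_nat_values)
        \<comment> \<open>The maximum matters for the empty partition, which has weight 0 while the
          expansion is required only from \<open>n = 1\<close> on.\<close>
        fix n assume n: "max 1 (wt \<mu>) \<le> n"
        have val: "Poly_Mapping.lookup (eval_Xi (monomial_sym lam) n) (block_perm 1 \<mu>) =
          poly (H \<mu>) (of_nat n)" if "Q H" for H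
        proof -
          have "eval_Xi (monomial_sym lam) n =
            (\<Sum>\<mu> | is_partition \<mu> \<and> wt \<mu> \<le> n. scalar (poly (H \<mu>) (of_nat n)) * class_sum \<mu> n)"
            using that n by (simp add: Q_def)
          then show ?thesis using n True
            by (simp add: lookup_class_expansion block_perm_in_Sym_group reduced_cycle_type_block_perm
                del: One_nat_def)
        qed
        show "poly (G' \<mu>) (of_nat n) = poly (G \<mu>) (of_nat n)"
          using val[OF \<open>Q G'\<close>] val[OF \<open>Q G\<close>] by simp
      qed
    qed
  qed
  ultimately have "class_poly (monomial_sym lam) = G"
    unfolding class_poly_def Q_def by (rule the_equality)
  then show ?thesis using assms by (simp add: G_def P N_def)
qed

section \<open>Minimal factorizations\<close>

text \<open>A list of \<open>k\<close> pairs, seen as a graph on \<open>A\<close>, has at least \<open>card A - k\<close> connected components;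
  the colouring labels the components.\<close>

lemma ex_colouring:
  assumes "finite A"
  shows "\<exists>f :: nat \<Rightarrow> nat. (\<forall>(s, t)\<in>set l. f s = f t) \<and> card A \<le> card (f ` A) + length l"
proof (induction l)
  case Nil
  show ?case by (rule exI[of _ id]) simp
next
  case (Cons a l)
  obtain s t where a: "a = (s, t)" by (cases a)
  obtain f :: "nat \<Rightarrow> nat" where f: "\<forall>(s, t)\<in>set l. f s = f t" "card A \<le> card (f ` A) + length l"
    using Cons by blast
  \<comment> \<open>Merge the components of \<open>s\<close> and \<open>t\<close> by recolouring
    that of \<open>t\<close>; at most one colour disappears.\<close>
  define g where "g x = (if f x = f t then f s else f x)" for x
  have "\<forall>(s, t)\<in>set (a # l). g s = g t" using f(1) by (auto simp: g_def a)
  moreover have "card (f ` A) \<le> Suc (card (g ` A))"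
  proof -
    have "f ` A - {f t} \<subseteq> g ` A"
    proof
      fix y assume "y \<in> f ` A - {f t}"
      then obtain x where "x \<in> A" "y = f x" "f x \<noteq> f t" by blast
      then show "y \<in> g ` A" by (auto simp: g_def image_iff intro!: bexI[of _ x])
    qed
    then have "card (f ` A - {f t}) \<le> card (g ` A)" using assms by (intro card_mono) auto
    then show ?thesis using card_Diff1_le[of "f ` A" "f t"]
      by (simp add: card_Diff_singleton_if split: if_splits)
  qed
  ultimately show ?case using f(2) by (intro exI[of _ g]) auto
qed

text \<open>Each transposition exchanges two points of the same colour.\<close>

lemma colouring_invariant:
  assumes "\<forall>(s, t)\<in>set l. f s = f t"
  shows "f (transp_prod l \<langle>$\<rangle> x) = f x"
  using assms
proof (induction l)
  case (Cons a l)
  obtain s t where a: "a = (s, t)" by (cases a)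
  define y where "y = transp_prod l \<langle>$\<rangle> x"
  have "f s = f t" "f y = f x" using Cons by (auto simp: a y_def)
  then have "f (\<langle>s \<leftrightarrow> t\<rangle> \<langle>$\<rangle> y) = f x" by (cases "y = s \<or> y = t") auto
  then show ?case by (simp add: a transp_prod_Cons apply_times y_def)
qed simp

lemma image_interval_cycle_invariant:
  assumes "\<And>x. x \<in> {a..a + k} \<Longrightarrow> f (interval_cycle a k \<langle>$\<rangle> x) = f x"
  shows "f ` {a..a + k} = {f a}"
proof -
  have "j \<le> k \<Longrightarrow> f (a + j) = f a" for j
  proof (induction j)
    case (Suc j)
    then show ?case using assms[of "a + j"] by (simp add: interval_cycle_apply)
  qed simp
  then have "f x = f a" if "x \<in> {a..a + k}" for x
    using that by (metis atLeastAtMost_iff le_add_diff_inverse nat_add_left_cancel_le)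
  then have "f ` {a..a + k} = (\<lambda>_. f a) ` {a..a + k}" by (rule image_cong[OF refl])
  then show ?thesis by (simp only: image_constant_conv) simp
qed

lemma atLeastLessThan_wt_Cons:
  "{a..<a + wt (k # c)} = {a..a + k} \<union> {Suc (a + k)..<Suc (a + k) + wt c}"
  by auto

text \<open>An invariant function is constant on each cycle, hence takes one value per
  block.\<close>

lemma card_image_block_perm_invariant:
  assumes "\<And>x. x \<in> {a..<a + wt c} \<Longrightarrow> f (block_perm a c \<langle>$\<rangle> x) = f x"
  shows "card (f ` {a..<a + wt c}) \<le> length c"
  using assms
proof (induction c arbitrary: a)
  case (Cons k c)
  let ?B = "{Suc (a + k)..<Suc (a + k) + wt c}"
  have "f (interval_cycle a k \<langle>$\<rangle> x) = f x" if "x \<in> {a..a + k}" for x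
    using Cons.prems[of x] that block_perm_Cons_apply_le[of x a k c] by simp
  then have 1: "f ` {a..a + k} = {f a}" by (rule image_interval_cycle_invariant)
  have "f (block_perm (Suc (a + k)) c \<langle>$\<rangle> x) = f x" if "x \<in> ?B" for x
    using Cons.prems[of x] that block_perm_Cons_apply_gt[of a k x c] by simp
  then have "card (f ` ?B) \<le> length c" by (rule Cons.IH)
  then show ?case
    unfolding atLeastLessThan_wt_Cons image_Un 1 by (simp add: card_insert_if)
qed simp

text \<open>The colouring has at least \<open>wt c - length l\<close> colours on the blocks, but
  invariance allows at most one colour per block. The difference of \<open>wt c\<close> and
  \<open>length c\<close> is \<open>sum_list c\<close>.\<close>

lemma sum_list_le_length_factorization:
  assumes "transp_prod l = block_perm a c"
  shows "sum_list c \<le> length l"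
proof -
  obtain f :: "nat \<Rightarrow> nat" where f: "\<forall>(s, t)\<in>set l. f s = f t"
      "card {a..<a + wt c} \<le> card (f ` {a..<a + wt c}) + length l"
    using ex_colouring[of "{a..<a + wt c}" l] by auto
  have "card (f ` {a..<a + wt c}) \<le> length c"
    by (rule card_image_block_perm_invariant) (simp add: colouring_invariant[OF f(1)] flip: assms)
  then show ?thesis using f(2) by (simp add: wt_def)
qed

text \<open>An edge between the first block and the rest would leave too few components.\<close>

lemma minimal_factorization_no_crossing:
  assumes prod: "transp_prod l = block_perm a (k # c)" and len: "length l = k + sum_list c"
    and st: "(s, t) \<in> set l" "a \<le> s" "s \<le> a + k" "a + k < t" "t < a + wt (k # c)"
  shows False
proof -
  let ?A = "{a..<a + wt (k # c)}" and ?B = "{Suc (a + k)..<Suc (a + k) + wt c}"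
  obtain f :: "nat \<Rightarrow> nat" where f: "\<forall>(s, t)\<in>set l. f s = f t" "card ?A \<le> card (f ` ?A) + length l"
    using ex_colouring[of ?A l] by auto
  have inv: "f (block_perm a (k # c) \<langle>$\<rangle> x) = f x" for x
    using colouring_invariant[OF f(1), of x] prod by simp
  have "f (interval_cycle a k \<langle>$\<rangle> x) = f x" if "x \<in> {a..a + k}" for x
    using inv[of x] that block_perm_Cons_apply_le[of x a k c] by simp
  then have 1: "f ` {a..a + k} = {f a}" by (rule image_interval_cycle_invariant)
  moreover have "s \<in> {a..a + k}" using st by simp
  ultimately have "f s = f a" by blast
  \<comment> \<open>The edge gives the first block the colour of a later one. The whole set then has
    at most \<open>length c\<close> colours, one fewer than minimal length forces.\<close>
  then have "f a = f t" using f(1) st(1) by auto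
  then have "f a \<in> f ` ?B" using st by (auto intro!: image_eqI[of _ _ t])
  then have "f ` ?A = f ` ?B" unfolding atLeastLessThan_wt_Cons image_Un 1 by blast
  moreover have "card (f ` ?B) \<le> length c"
  proof (rule card_image_block_perm_invariant)
    fix x assume "x \<in> ?B"
    then show "f (block_perm (Suc (a + k)) c \<langle>$\<rangle> x) = f x"
      using inv[of x] block_perm_Cons_apply_gt[of a k x c] by simp
  qed
  ultimately show False using f(2) len by (simp add: wt_def)
qed

text \<open>By \<open>sum_list_le_length_factorization\<close> the prescribed length is the least
  possible one.\<close>

definition cycle_factorizations :: "nat \<Rightarrow> nat \<Rightarrow> (nat \<times> nat) list set" where
  "cycle_factorizations a k = {l \<in> mono_factorizations {a..a + k} (interval_cycle a k). length l = k}"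

definition block_factorizations :: "nat \<Rightarrow> nat list \<Rightarrow> (nat \<times> nat) list set" where
  "block_factorizations a c =
    {l \<in> mono_factorizations {a..<a + wt c} (block_perm a c). length l = sum_list c}"

lemma filter_append_sorted:
  fixes f :: "'a \<Rightarrow> 'b :: linorder"
  assumes "sorted (map f l)"
  shows "filter (\<lambda>x. f x \<le> v) l @ filter (\<lambda>x. \<not> f x \<le> v) l = l"
  using assms
proof (induction l)
  case (Cons x l)
  show ?case
  proof (cases "f x \<le> v")
    case False
    then have "\<forall>y\<in>set l. \<not> f y \<le> v" using Cons.prems by fastforce
    then have "filter (\<lambda>x. f x \<le> v) l = []" "filter (\<lambda>x. \<not> f x \<le> v) l = l"
      by (auto simp: filter_empty_conv filter_id_conv)
    then show ?thesis using False by simp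
  qed (use Cons in auto)
qed simp

lemma perm_mult_disjoint_eqD:
  fixes P Q P' Q' :: "'a perm"
  assumes eq: "P * Q = P' * Q'" and "affected P \<subseteq> A" "affected P' \<subseteq> A" "affected Q \<subseteq> B"
    "affected Q' \<subseteq> B" "A \<inter> B = {}"
  shows "P = P'" and "Q = Q'"
proof -
  show P: "P = P'"
  proof (rule perm_eqI)
    fix x
    show "P \<langle>$\<rangle> x = P' \<langle>$\<rangle> x"
    proof (cases "x \<in> A")
      case True
      then have "x \<notin> affected Q" "x \<notin> affected Q'" using assms by blast+
      then have "(P * Q) \<langle>$\<rangle> x = P \<langle>$\<rangle> x" "(P' * Q') \<langle>$\<rangle> x = P' \<langle>$\<rangle> x"
        by (simp_all add: apply_times in_affected)
      then show ?thesis using eq by simp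
    next
      case False
      then have "x \<notin> affected P" "x \<notin> affected P'" using assms by blast+
      then show ?thesis by (simp add: in_affected)
    qed
  qed
  show "Q = Q'" using eq unfolding P by (simp flip: plus_perm_def)
qed

text \<open>Since the larger points increase, those in the first block form an initial segment of
  the list. No pair crosses out of the first block, so the two segments act on disjoint intervals
  and multiply separately to the two parts of the permutation.\<close>

lemma block_factorizations_Cons:
  "block_factorizations a (k # c) =
    (\<lambda>(l1, l2). l1 @ l2) ` (cycle_factorizations a k \<times> block_factorizations (Suc (a + k)) c)"
proof (intro equalityI subsetI)
  let ?I = "{a..a + k}" and ?B = "{Suc (a + k)..<Suc (a + k) + wt c}"
  fix l assume "l \<in> block_factorizations a (k # c)"
  then have l: "sorted (map snd l)" "moved_points l \<subseteq> {a..<a + wt (k # c)}" "\<forall>(s, t)\<in>set l. s < t"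
      "transp_prod l = block_perm a (k # c)" "length l = k + sum_list c"
    by (auto simp: block_factorizations_def mono_factorizations_alt simp del: block_perm.simps wt_Cons)
  define l1 where "l1 = filter (\<lambda>x. snd x \<le> a + k) l"
  define l2 where "l2 = filter (\<lambda>x. \<not> snd x \<le> a + k) l"
  have l12: "l = l1 @ l2" unfolding l1_def l2_def by (rule filter_append_sorted[OF l(1), symmetric])
  have st: "a \<le> s" "t < a + wt (k # c)" "s < t" if "(s, t) \<in> set l" for s t
    using l(2,3) that by (auto simp: moved_points_subset_iff simp del: wt_Cons)
  have mp1: "moved_points l1 \<subseteq> ?I"
    unfolding moved_points_subset_iff l1_def using st by fastforce
  have mp2: "moved_points l2 \<subseteq> ?B"
    unfolding moved_points_subset_iff
  proof safe
    fix s t assume "(s, t) \<in> set l2"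
    then have *: "(s, t) \<in> set l" "a + k < t" by (auto simp: l2_def)
    then have "a + k < s"
      using minimal_factorization_no_crossing[OF l(4,5) *(1)] st[OF *(1)] by fastforce
    then show "s \<in> ?B" "t \<in> ?B" using st[OF *(1)] * by auto
  qed
  have prod12: "transp_prod l1 * transp_prod l2 = interval_cycle a k * block_perm (Suc (a + k)) c"
    using l(4) by (simp add: l12 transp_prod_append)
  have sub: "affected (transp_prod l1) \<subseteq> ?I" "affected (transp_prod l2) \<subseteq> ?B"
    using affected_transp_prod mp1 mp2 by blast+
  have "?I \<inter> ?B = {}" by auto
  note p1 = perm_mult_disjoint_eqD(1)[OF prod12 sub(1) affected_interval_cycle sub(2)
      affected_block_perm this]
    and p2 = perm_mult_disjoint_eqD(2)[OF prod12 sub(1) affected_interval_cycle sub(2)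
      affected_block_perm this]
  \<comment> \<open>Both segments have at least the minimal length for their part, and the lengths
    add up to the total minimum, so each is minimal.\<close>
  have "k \<le> length l1" "sum_list c \<le> length l2"
    using sum_list_le_length_factorization[of l1 a "[k]"] p1
      sum_list_le_length_factorization[OF p2] by auto
  then have "length l1 = k" "length l2 = sum_list c" using l(5) by (auto simp: l12)
  moreover have "sorted (map snd l1)" "sorted (map snd l2)" using l(1) by (auto simp: l12 sorted_append)
  moreover have "\<forall>(s, t)\<in>set l1. s < t" "\<forall>(s, t)\<in>set l2. s < t" using l(3) by (auto simp: l12)
  ultimately have "l1 \<in> cycle_factorizations a k" "l2 \<in> block_factorizations (Suc (a + k)) c"
    using p1 p2 mp1 mp2
    by (auto simp: cycle_factorizations_def block_factorizations_def mono_factorizations_alt)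
  then show "l \<in> (\<lambda>(l1, l2). l1 @ l2) `
      (cycle_factorizations a k \<times> block_factorizations (Suc (a + k)) c)"
    using l12 by auto
next
  let ?I = "{a..a + k}" and ?B = "{Suc (a + k)..<Suc (a + k) + wt c}"
  fix l assume "l \<in> (\<lambda>(l1, l2). l1 @ l2) `
      (cycle_factorizations a k \<times> block_factorizations (Suc (a + k)) c)"
  then obtain l1 l2 where l: "l = l1 @ l2" "l1 \<in> cycle_factorizations a k"
    "l2 \<in> block_factorizations (Suc (a + k)) c" by auto
  have l1: "sorted (map snd l1)" "moved_points l1 \<subseteq> ?I" "\<forall>(s, t)\<in>set l1. s < t"
      "transp_prod l1 = interval_cycle a k" "length l1 = k"
    and l2: "sorted (map snd l2)" "moved_points l2 \<subseteq> ?B" "\<forall>(s, t)\<in>set l2. s < t"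
      "transp_prod l2 = block_perm (Suc (a + k)) c" "length l2 = sum_list c"
    using l by (simp_all add: cycle_factorizations_def block_factorizations_def mono_factorizations_alt)
  have "\<forall>x\<in>set l1. snd x \<le> a + k" "\<forall>x\<in>set l2. a + k < snd x"
    using l1(2) l2(2) by (fastforce simp: moved_points_subset_iff)+
  then have "sorted (map snd l)" using l1(1) l2(1) by (fastforce simp: l(1) sorted_append)
  moreover have "moved_points l \<subseteq> {a..<a + wt (k # c)}"
    unfolding atLeastLessThan_wt_Cons using l1(2) l2(2) unfolding l(1) moved_points_def by auto
  ultimately show "l \<in> block_factorizations a (k # c)"
    using l1 l2 by (auto simp: l(1) block_factorizations_def mono_factorizations_alt transp_prod_append)
qed

lemma block_factorizations_Nil: "block_factorizations a [] = {[]}"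
  by (auto simp: block_factorizations_def mono_factorizations_alt moved_points_def)

lemma block_factorizations_single: "block_factorizations a [k] = cycle_factorizations a k"
  by (auto simp: block_factorizations_Cons block_factorizations_Nil image_iff)

lemma block_factorizations_pair:
  "block_factorizations a [j, k] =
    (\<lambda>(l1, l2). l1 @ l2) ` (cycle_factorizations a j \<times> cycle_factorizations (Suc (a + j)) k)"
  by (subst block_factorizations_Cons) (simp only: block_factorizations_single)

text \<open>Multiplying a cycle by a transposition of two of its points splits it. As one of them is
  the last point, both pieces are again cycles on intervals.\<close>

lemma interval_cycle_mult_swap:
  assumes "j \<le> k"
  shows "interval_cycle a (Suc k) * \<langle>a + j \<leftrightarrow> a + Suc k\<rangle> = block_perm a [j, k - j]"
proof (rule perm_eqI)
  fix x
  consider "x = a + j" | "x = a + Suc k" | "x \<noteq> a + j" "x \<noteq> a + Suc k" by blast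
  then show "(interval_cycle a (Suc k) * \<langle>a + j \<leftrightarrow> a + Suc k\<rangle>) \<langle>$\<rangle> x = block_perm a [j, k - j] \<langle>$\<rangle> x"
    using assms by cases (auto simp: apply_times interval_cycle_apply simp del: interval_cycle.simps)
qed

lemma cycle_factorizations_0: "cycle_factorizations a 0 = {[]}"
  by (auto simp: cycle_factorizations_def mono_factorizations_alt moved_points_def)

text \<open>The last transposition involves the largest point, and splits the cycle into two intervals.\<close>

lemma cycle_factorizations_Suc_iff:
  "l \<in> cycle_factorizations a (Suc k) \<longleftrightarrow> (\<exists>j\<le>k. \<exists>l1\<in>cycle_factorizations a j.
    \<exists>l2\<in>cycle_factorizations (Suc (a + j)) (k - j). l = l1 @ l2 @ [(a + j, a + Suc k)])"
    (is "?L \<longleftrightarrow> ?R")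
proof -
  have rng: "{a..<a + wt [j, k - j]} = {a..a + Suc k}" if "j \<le> k" for j using that by auto
  have R: "?R \<longleftrightarrow> (\<exists>j\<le>k. \<exists>l'\<in>block_factorizations a [j, k - j]. l = l' @ [(a + j, a + Suc k)])"
    unfolding block_factorizations_pair by auto
  show ?thesis unfolding R
  proof
    assume ?L
    then have l: "sorted (map snd l)" "moved_points l \<subseteq> {a..a + Suc k}" "\<forall>(s, t)\<in>set l. s < t"
        "transp_prod l = interval_cycle a (Suc k)" "length l = Suc k"
      by (simp_all add: cycle_factorizations_def mono_factorizations_alt del: interval_cycle.simps)
    then obtain l' s t where l': "l = l' @ [(s, t)]" by (metis length_Suc_conv_rev surj_pair)
    \<comment> \<open>The largest point is moved, so it occurs in the list, necessarily as the
      larger point of a pair; by sortedness the last pair has it too.\<close>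
    have "a + Suc k \<in> affected (transp_prod l)"
      unfolding l(4) in_affected interval_cycle_apply by simp
    then have "a + Suc k \<in> moved_points l" using affected_transp_prod by blast
    then obtain x where x: "x \<in> set l" "a + Suc k = fst x \<or> a + Suc k = snd x"
      by (auto simp: moved_points_def)
    moreover have "fst x < snd x" "snd x \<le> a + Suc k"
      using x(1) l(2,3) by (fastforce simp: moved_points_subset_iff)+
    ultimately have "snd x = a + Suc k" by auto
    moreover have "snd x \<le> t" using l(1) x(1) by (auto simp: l' sorted_append)
    moreover have "t \<le> a + Suc k" "a \<le> s" "s < t" using l(2,3) by (auto simp: l' moved_points_def)
    ultimately have t: "t = a + Suc k" and s: "a \<le> s" "s \<le> a + k" by auto
    define j where "j = s - a"
    have j: "s = a + j" "j \<le> k" using s by (auto simp: j_def)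
    have "transp_prod l' * \<langle>s \<leftrightarrow> t\<rangle> = interval_cycle a (Suc k)"
      using l(4) by (simp add: l' transp_prod_append transp_prod_Cons del: interval_cycle.simps)
    then have "interval_cycle a (Suc k) * \<langle>s \<leftrightarrow> t\<rangle> = transp_prod l' * (\<langle>s \<leftrightarrow> t\<rangle> * \<langle>s \<leftrightarrow> t\<rangle>)"
      by (metis mult.assoc)
    then have "transp_prod l' = block_perm a [j, k - j]"
      using interval_cycle_mult_swap[OF j(2), of a] unfolding j(1) t by simp
    moreover have "sorted (map snd l')" "moved_points l' \<subseteq> {a..a + Suc k}" "\<forall>(s, t)\<in>set l'. s < t"
        "length l' = k"
      using l by (auto simp: l' sorted_append moved_points_def)
    ultimately have "l' \<in> block_factorizations a [j, k - j]"
      unfolding block_factorizations_def mem_Collect_eq mono_factorizations_alt rng[OF j(2)]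
      using j(2) by simp
    then show "\<exists>j\<le>k. \<exists>l'\<in>block_factorizations a [j, k - j]. l = l' @ [(a + j, a + Suc k)]"
      using j t l' by blast
  next
    assume "\<exists>j\<le>k. \<exists>l'\<in>block_factorizations a [j, k - j]. l = l' @ [(a + j, a + Suc k)]"
    then obtain j l' where j: "j \<le> k" and l'B: "l' \<in> block_factorizations a [j, k - j]"
      and l: "l = l' @ [(a + j, a + Suc k)]" by blast
    have l': "sorted (map snd l')" "moved_points l' \<subseteq> {a..a + Suc k}" "\<forall>(s, t)\<in>set l'. s < t"
        "transp_prod l' = block_perm a [j, k - j]" "length l' = k"
      using l'B j unfolding block_factorizations_def mem_Collect_eq mono_factorizations_alt rng[OF j]
      by auto
    have "transp_prod l = interval_cycle a (Suc k) * \<langle>a + j \<leftrightarrow> a + Suc k\<rangle> * \<langle>a + j \<leftrightarrow> a + Suc k\<rangle>"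
      unfolding l transp_prod_append l'(4) interval_cycle_mult_swap[OF j] by (simp add: transp_prod_Cons)
    then have "transp_prod l = interval_cycle a (Suc k)"
      by (simp add: mult.assoc del: interval_cycle.simps)
    moreover have "\<forall>x\<in>set l'. snd x \<le> a + Suc k" using l'(2) by (fastforce simp: moved_points_subset_iff)
    then have "sorted (map snd l)" using l'(1) by (auto simp: l sorted_append)
    moreover have "moved_points l \<subseteq> {a..a + Suc k}" using l'(2) j by (auto simp: l moved_points_def)
    moreover have "\<forall>(s, t)\<in>set l. s < t" using l'(3) j by (auto simp: l)
    ultimately show ?L using l'(5)
      by (simp add: cycle_factorizations_def mono_factorizations_alt l del: interval_cycle.simps)
  qed
qed

section \<open>Refined Catalan numbers\<close>

text \<open>The sequences of \<open>catalan_seqs\<close> shifted by \<open>a\<close>. The condition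
  on the last letter is replaced by an upper bound on all letters, which also gives a sensible base
  case at \<open>k = 0\<close>.\<close>

definition catalan_words :: "nat \<Rightarrow> nat \<Rightarrow> nat list set" where
  "catalan_words a k = {t. length t = k \<and> sorted t \<and> (\<forall>p<k. a + Suc p \<le> t ! p) \<and>
     (\<forall>x\<in>set t. x \<le> a + k)}"

lemma catalan_words_last:
  assumes "t \<in> catalan_words a (Suc k)"
  shows "t ! k = a + Suc k"
proof (rule antisym)
  have "t ! k \<in> set t" using assms by (simp add: catalan_words_def)
  then show "t ! k \<le> a + Suc k" using assms by (simp add: catalan_words_def)
qed (use assms in \<open>simp add: catalan_words_def\<close>)

text \<open>The letters of \<open>t1\<close> are at most \<open>a + j\<close> and those of
  \<open>t2\<close> exceed it, so the concatenation stays sorted.\<close>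

lemma catalan_words_append:
  assumes j: "j \<le> k" and t1: "t1 \<in> catalan_words a j" and t2: "t2 \<in> catalan_words (Suc (a + j)) (k - j)"
  shows "t1 @ t2 @ [a + Suc k] \<in> catalan_words a (Suc k)"
proof -
  have l: "length t1 = j" "length t2 = k - j" using t1 t2 by (simp_all add: catalan_words_def)
  have b1: "\<forall>x\<in>set t1. x \<le> a + j" using t1 by (simp add: catalan_words_def)
  have b2: "\<forall>x\<in>set t2. x \<le> a + Suc k" using t2 j by (simp add: catalan_words_def)
  have b3: "\<forall>x\<in>set t2. a + j < x"
  proof
    fix x assume "x \<in> set t2"
    then obtain p where "p < k - j" "x = t2 ! p" using l by (auto simp: in_set_conv_nth)
    then show "a + j < x" using t2 by (fastforce simp: catalan_words_def)
  qed
  have "sorted (t1 @ t2 @ [a + Suc k])"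
    using t1 t2 b1 b2 b3 j by (fastforce simp: catalan_words_def sorted_append)
  moreover have "a + Suc p \<le> (t1 @ t2 @ [a + Suc k]) ! p" if p: "p < Suc k" for p
  proof -
    consider "p < j" | "j \<le> p" "p < k" | "p = k" using p by linarith
    then show ?thesis
    proof cases
      case 1
      then show ?thesis using t1 l by (simp add: nth_append catalan_words_def)
    next
      case 2
      then have "p - j < k - j" by simp
      then have "Suc (a + j) + Suc (p - j) \<le> t2 ! (p - j)" using t2 by (simp add: catalan_words_def)
      then show ?thesis using 2 l by (simp add: nth_append)
    next
      case 3
      then show ?thesis using l j by (simp add: nth_append)
    qed
  qed
  ultimately show ?thesis using l j b1 b2 by (auto simp: catalan_words_def)
qed

text \<open>The cut is at the last position \<open>j \<le> k\<close> where the bound \<open>a + j \<le> t ! (j - 1)\<close> is attained.\<close>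

lemma catalan_words_Suc_cases:
  assumes t: "t \<in> catalan_words a (Suc k)"
  obtains j t1 t2 where "j \<le> k" "t1 \<in> catalan_words a j" "t2 \<in> catalan_words (Suc (a + j)) (k - j)"
    "t = t1 @ t2 @ [a + Suc k]"
proof -
  \<comment> \<open>The value 0 is included by convention, so that a maximum exists; it stands for
    an empty first part.\<close>
  define J where "J = {j. j \<le> k \<and> (j = 0 \<or> t ! (j - 1) = a + j)}"
  have "finite J" "0 \<in> J" by (auto simp: J_def)
  define j where "j = Max J"
  have "j \<in> J" unfolding j_def using \<open>finite J\<close> \<open>0 \<in> J\<close> by (intro Max_in) auto
  have max: "i \<le> j" if "i \<in> J" for i unfolding j_def using \<open>finite J\<close> that by simp
  have jk: "j \<le> k" using \<open>j \<in> J\<close> by (simp add: J_def)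
  have T: "length t = Suc k" "sorted t" "\<And>p. p < Suc k \<Longrightarrow> a + Suc p \<le> t ! p"
      "\<And>x. x \<in> set t \<Longrightarrow> x \<le> a + Suc k"
    using t by (auto simp: catalan_words_def)
  define t1 where "t1 = take j t"
  define t2 where "t2 = take (k - j) (drop j t)"
  have "drop k t = [t ! k]" using T(1) Cons_nth_drop_Suc[of k t] by simp
  then have "t = take k t @ [a + Suc k]" using catalan_words_last[OF t] by (metis append_take_drop_id)
  moreover have "take k t = t1 @ t2"
    using jk by (simp add: t1_def t2_def flip: take_add)
  ultimately have eq: "t = t1 @ t2 @ [a + Suc k]" by simp
  have "t1 \<in> catalan_words a j"
  proof -
    have "x \<le> a + j" if "x \<in> set t1" for x
    proof -
      obtain p where p: "p < j" "x = t ! p" using \<open>x \<in> set t1\<close> T(1) jk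
        by (auto simp: t1_def in_set_conv_nth)
      then have "x \<le> t ! (j - 1)" using T(1,2) jk by (auto intro: sorted_nth_mono)
      also have "\<dots> = a + j" using \<open>j \<in> J\<close> p(1) by (simp add: J_def)
      finally show ?thesis .
    qed
    then show ?thesis using T jk by (auto simp: catalan_words_def t1_def)
  qed
  moreover have "t2 \<in> catalan_words (Suc (a + j)) (k - j)"
  proof -
    have "Suc (a + j) + Suc p \<le> t2 ! p" if p: "p < k - j" for p
    proof -
      \<comment> \<open>By maximality the lower bound is not attained after the cut. The letters
        there exceed it by at least one, which is the bound for words starting at
        \<open>Suc (a + j)\<close>.\<close>
      have "Suc (j + p) \<notin> J" using max[of "Suc (j + p)"] by auto
      then have "t ! (j + p) \<noteq> a + Suc (j + p)" using p by (simp add: J_def)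
      moreover have "a + Suc (j + p) \<le> t ! (j + p)" using p by (intro T(3)) simp
      ultimately show ?thesis using T(1) p by (simp add: t2_def)
    qed
    moreover have "x \<le> Suc (a + j) + (k - j)" if "x \<in> set t2" for x
      using that T(4)[of x] jk by (auto simp: t2_def dest: in_set_takeD in_set_dropD)
    ultimately show ?thesis using T(1,2) jk
      by (auto simp: catalan_words_def t2_def sorted_wrt_take sorted_wrt_drop)
  qed
  ultimately show ?thesis using that[OF jk] eq by blast
qed

text \<open>Compare the letters at position \<open>j' - 1\<close>: the word cut at \<open>j'\<close>
  attains the lower bound there, while in the word cut at \<open>j\<close> this position belongs to
  \<open>t2\<close> and lies strictly above the bound.\<close>

lemma catalan_words_cut_unique:
  assumes "j < j'" "j' \<le> k" and t1': "t1' \<in> catalan_words a j'"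
    and t1: "t1 \<in> catalan_words a j" and t2: "t2 \<in> catalan_words (Suc (a + j)) (k - j)"
  shows "t1 @ t2 @ u \<noteq> t1' @ t2' @ u'"
proof
  assume eq: "t1 @ t2 @ u = t1' @ t2' @ u'"
  have "length t1 = j" "length t2 = k - j" "length t1' = j'"
    using t1 t2 t1' by (simp_all add: catalan_words_def)
  then have "(t1 @ t2 @ u) ! (j' - 1) = t2 ! (j' - 1 - j)" "(t1' @ t2' @ u') ! (j' - 1) = t1' ! (j' - 1)"
    using assms(1,2) by (auto simp: nth_append)
  moreover have "t1' ! (j' - 1) = a + j'"
    using catalan_words_last[of t1' a "j' - 1"] t1' assms(1) by simp
  moreover have "j' - 1 - j < k - j" using assms(1,2) by simp
  then have "Suc (a + j) + Suc (j' - 1 - j) \<le> t2 ! (j' - 1 - j)"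
    using t2 by (simp add: catalan_words_def)
  ultimately show False using eq assms(1) by simp
qed

text \<open>Both sides decompose at a cut \<open>j\<close> into smaller instances of themselves. The
  word determines its cut, and the cut is the smaller point \<open>a + j\<close> of the last
  transposition, so forgetting the smaller points loses nothing.\<close>

lemma bij_betw_map_snd_cycle_factorizations:
  "bij_betw (map snd) (cycle_factorizations a k) (catalan_words a k)"
proof (induction k arbitrary: a rule: less_induct)
  case (less k)
  show ?case
  proof (cases k)
    case 0
    have "catalan_words a 0 = {[]}" by (auto simp: catalan_words_def)
    then show ?thesis by (simp add: 0 cycle_factorizations_0 bij_betw_def)
  next
    case (Suc m)
    have IH: "bij_betw (map snd) (cycle_factorizations b i) (catalan_words b i)" if "i \<le> m" for b i
      using less[of i b] that Suc by simp
    have IH_mem: "map snd l \<in> catalan_words b i" if "l \<in> cycle_factorizations b i" "i \<le> m" for l b i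
      using IH[OF that(2)] that(1) by (auto simp: bij_betw_def)
    have IH_inj: "l = l'" if "l \<in> cycle_factorizations b i" "l' \<in> cycle_factorizations b i" "i \<le> m"
      "map snd l = map snd l'" for l l' b i
      using IH[OF that(3)] that by (auto simp: bij_betw_def dest: inj_onD)
    have "inj_on (map snd) (cycle_factorizations a (Suc m))"
    proof (rule inj_onI)
      fix l l' assume "l \<in> cycle_factorizations a (Suc m)" "l' \<in> cycle_factorizations a (Suc m)"
        and eq: "map snd l = map snd l'"
      then obtain j l1 l2 j' l1' l2' where
        j: "j \<le> m" "l1 \<in> cycle_factorizations a j" "l2 \<in> cycle_factorizations (Suc (a + j)) (m - j)"
          "l = l1 @ l2 @ [(a + j, a + Suc m)]" and
        j': "j' \<le> m" "l1' \<in> cycle_factorizations a j'" "l2' \<in> cycle_factorizations (Suc (a + j')) (m - j')"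
          "l' = l1' @ l2' @ [(a + j', a + Suc m)]"
        unfolding cycle_factorizations_Suc_iff by blast
      note w = IH_mem[OF j(2,1)] IH_mem[OF j(3) diff_le_self]
        IH_mem[OF j'(2,1)] IH_mem[OF j'(3) diff_le_self]
      have eq': "map snd l1 @ map snd l2 @ [a + Suc m] = map snd l1' @ map snd l2' @ [a + Suc m]"
        using eq j(4) j'(4) by simp
      have "j = j'"
      proof (rule ccontr)
        assume "j \<noteq> j'"
        then consider "j < j'" | "j' < j" by linarith
        then show False
        proof cases
          case 1
          then show False using catalan_words_cut_unique[OF 1 j'(1) w(3,1,2)] eq' by blast
        next
          case 2
          then show False using catalan_words_cut_unique[OF 2 j(1) w(1,3,4)] eq'[symmetric] by blast
        qed
      qed
      have "length l1 = length l1'"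
        using j(2) j'(2) \<open>j = j'\<close> by (simp add: cycle_factorizations_def)
      then have "map snd l1 = map snd l1'" "map snd l2 = map snd l2'"
        using eq' by simp_all
      then have "l1 = l1'" "l2 = l2'"
        using IH_inj[OF j(2) _ j(1)] IH_inj[OF j(3) _ diff_le_self] j' \<open>j = j'\<close> by blast+
      then show "l = l'" using j j' \<open>j = j'\<close> by simp
    qed
    moreover have "map snd l \<in> catalan_words a (Suc m)" if l: "l \<in> cycle_factorizations a (Suc m)" for l
    proof -
      obtain j l1 l2 where j: "j \<le> m" "l1 \<in> cycle_factorizations a j"
          "l2 \<in> cycle_factorizations (Suc (a + j)) (m - j)" "l = l1 @ l2 @ [(a + j, a + Suc m)]"
        using l unfolding cycle_factorizations_Suc_iff by blast
      show ?thesis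
        using catalan_words_append[OF j(1) IH_mem[OF j(2,1)] IH_mem[OF j(3) diff_le_self]] j(4) by simp
    qed
    moreover have "t \<in> map snd ` cycle_factorizations a (Suc m)" if t: "t \<in> catalan_words a (Suc m)" for t
    proof -
      obtain j t1 t2 where j: "j \<le> m" "t1 \<in> catalan_words a j"
          "t2 \<in> catalan_words (Suc (a + j)) (m - j)" "t = t1 @ t2 @ [a + Suc m]"
        using catalan_words_Suc_cases[OF t] by blast
      obtain l1 where l1: "l1 \<in> cycle_factorizations a j" "t1 = map snd l1"
        using IH[OF j(1), of a] j(2) by (auto simp: bij_betw_def)
      obtain l2 where l2: "l2 \<in> cycle_factorizations (Suc (a + j)) (m - j)" "t2 = map snd l2"
        using IH[of "m - j" "Suc (a + j)"] j(3) by (auto simp: bij_betw_def)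
      have "l1 @ l2 @ [(a + j, a + Suc m)] \<in> cycle_factorizations a (Suc m)"
        unfolding cycle_factorizations_Suc_iff using j(1) l1(1) l2(1) by blast
      moreover have "t = map snd (l1 @ l2 @ [(a + j, a + Suc m)])" using j(4) l1(2) l2(2) by simp
      ultimately show ?thesis by blast
    qed
    ultimately show ?thesis unfolding Suc bij_betw_def by blast
  qed
qed

lemma catalan_words_0_eq_catalan_seqs:
  assumes "k > 0"
  shows "catalan_words 0 k = catalan_seqs k"
proof (intro equalityI subsetI)
  fix t assume t: "t \<in> catalan_words 0 k"
  have len: "length t = k" and bound: "\<And>p. p < k \<Longrightarrow> Suc p \<le> t ! p"
    using t by (auto simp: catalan_words_def)
  have "1 \<le> x" if x: "x \<in> set t" for x
  proof -
    obtain p where "p < k" "x = t ! p" using x len by (auto simp: in_set_conv_nth)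
    then show ?thesis using bound[of p] by simp
  qed
  moreover have "p \<le> t ! (p - 1)" if "p \<in> {1..k - 1}" for p
  proof -
    have "p - 1 < k" "Suc (p - 1) = p" using that by auto
    then show ?thesis using bound[of "p - 1"] by simp
  qed
  moreover have "t ! (k - 1) = k" using catalan_words_last[of t 0 "k - 1"] t assms by simp
  ultimately show "t \<in> catalan_seqs k" using t by (auto simp: catalan_words_def catalan_seqs_def)
next
  fix t assume t: "t \<in> catalan_seqs k"
  have len: "length t = k" and bound: "\<And>p. p \<in> {1..k - 1} \<Longrightarrow> p \<le> t ! (p - 1)"
    and last: "t ! (k - 1) = k" and sorted: "sorted t"
    using t by (simp_all add: catalan_seqs_def)
  have "Suc p \<le> t ! p" if p: "p < k" for p
  proof (cases "Suc p = k")
    case True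
    then show ?thesis using last by auto
  next
    case False
    then show ?thesis using bound[of "Suc p"] p by simp
  qed
  moreover have "x \<le> k" if x: "x \<in> set t" for x
  proof -
    obtain p where "p < k" "x = t ! p" using x len by (auto simp: in_set_conv_nth)
    then show ?thesis using sorted_nth_mono[OF sorted, of p "k - 1"] len last by simp
  qed
  ultimately show "t \<in> catalan_words 0 k" using len sorted by (simp add: catalan_words_def)
qed

lemma catalan_words_shift: "catalan_words a k = map ((+) a) ` catalan_words 0 k"
proof (intro equalityI subsetI)
  fix t assume t: "t \<in> catalan_words a k"
  have len: "length t = k" and bound: "\<And>p. p < k \<Longrightarrow> a + Suc p \<le> t ! p"
    using t by (auto simp: catalan_words_def)
  define u where "u = map (\<lambda>x. x - a) t"
  have "a \<le> x" if x: "x \<in> set t" for x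
  proof -
    obtain p where "p < k" "x = t ! p" using x len by (auto simp: in_set_conv_nth)
    then show ?thesis using bound[of p] by simp
  qed
  then have tu: "t = map ((+) a) u" by (simp add: u_def map_idI)
  have "u \<in> catalan_words 0 k" using t unfolding tu by (auto simp: catalan_words_def sorted_map)
  then show "t \<in> map ((+) a) ` catalan_words 0 k" using tu by blast
next
  fix t assume "t \<in> map ((+) a) ` catalan_words 0 k"
  then show "t \<in> catalan_words a k" by (auto simp: catalan_words_def sorted_map)
qed

lemma partition_of_0_iff: "\<nu> \<turnstile> 0 \<longleftrightarrow> \<nu> = []"
  by (cases \<nu>) (auto simp: partition_of_def is_partition_def)

lemma card_cycle_factorizations_type:
  assumes "\<nu> \<turnstile> k"
  shows "card {l \<in> cycle_factorizations a k. seq_type (map snd l) = \<nu>} = RC \<nu>"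
proof -
  have "bij_betw (map snd) {l \<in> cycle_factorizations a k. seq_type (map snd l) = \<nu>}
      {t \<in> catalan_words a k. seq_type t = \<nu>}"
    using bij_betw_map_snd_cycle_factorizations[of a k]
    by (auto simp: bij_betw_def inj_on_def)
  then have 1: "card {l \<in> cycle_factorizations a k. seq_type (map snd l) = \<nu>} =
      card {t \<in> catalan_words a k. seq_type t = \<nu>}" by (rule bij_betw_same_card)
  show ?thesis
  \<comment> \<open>\<open>RC\<close> fixes the value at the empty partition separately; it agrees
    with the single empty word.\<close>
  proof (cases "k = 0")
    case True
    then have "\<nu> = []" using assms by (simp add: partition_of_0_iff)
    moreover have "{t \<in> catalan_words a 0. seq_type t = []} = {[]}"
      by (auto simp: catalan_words_def seq_type_def sort_desc_def)
    ultimately show ?thesis using 1 True by (simp add: RC_def)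
  next
    case False
    have "{t \<in> catalan_words a k. seq_type t = \<nu>} =
        map ((+) a) ` {t \<in> catalan_seqs k. seq_type t = \<nu>}"
      unfolding catalan_words_shift[of a] using False
      by (auto simp: catalan_words_0_eq_catalan_seqs seq_type_map_inj)
    moreover have "inj_on (map ((+) a)) X" for X by (auto simp: inj_on_def)
    ultimately have "card {t \<in> catalan_words a k. seq_type t = \<nu>} =
        card {t \<in> catalan_seqs k. seq_type t = \<nu>}"
      by (simp add: card_image)
    moreover have "sum_list \<nu> = k" "\<nu> \<noteq> []" using assms False by (auto simp: partition_of_def)
    ultimately show ?thesis using 1 by (simp add: RC_def)
  qed
qed

section \<open>Distribution of the type over the blocks, and the final count\<close>

lemma seq_type_partition: "seq_type ts \<turnstile> length ts"
proof -
  have "sorted_wrt (\<ge>) (seq_type ts)"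
    by (simp add: seq_type_def sort_desc_def sorted_wrt_rev)
  moreover have "0 < x" if "x \<in> set (seq_type ts)" for x
    using that by (auto simp: seq_type_def sort_desc_def count_list_0_iff intro: Nat.gr0I)
  ultimately show ?thesis by (simp add: partition_of_def is_partition_def sum_list_seq_type)
qed

text \<open>Words without common letters do not influence each other's multiplicities.\<close>

lemma mset_seq_type_append:
  assumes "set ts \<inter> set us = {}"
  shows "mset (seq_type (ts @ us)) = mset (seq_type ts) + mset (seq_type us)"
proof -
  have "image_mset (count (mset (ts @ us))) (mset_set (set ts)) =
      image_mset (count (mset ts)) (mset_set (set ts))"
    "image_mset (count (mset (ts @ us))) (mset_set (set us)) =
      image_mset (count (mset us)) (mset_set (set us))"
    using assms by (auto intro!: image_mset_cong count_notin simp: count_mset)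
  then show ?thesis using assms by (simp add: mset_seq_type mset_set_Union del: mset_append)
qed

lemma finite_partition_of: "finite {\<nu>. \<nu> \<turnstile> k}"
proof (rule finite_subset)
  show "{\<nu>. \<nu> \<turnstile> k} \<subseteq> {\<mu>. is_partition \<mu> \<and> wt \<mu> \<le> 2 * k}"
  proof clarify
    fix \<nu> assume \<nu>: "\<nu> \<turnstile> k"
    have "\<forall>x\<in>set xs. 0 < x \<Longrightarrow> length xs \<le> sum_list xs" for xs :: "nat list"
      by (induction xs) auto
    moreover have "\<forall>x\<in>set \<nu>. 0 < x" using \<nu> by (simp add: partition_of_def is_partition_def)
    ultimately have "length \<nu> \<le> sum_list \<nu>" by blast
    then show "is_partition \<nu> \<and> wt \<nu> \<le> 2 * k" using \<nu> by (simp add: partition_of_def wt_def)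
  qed
qed (rule finite_partitions_wt_le)

text \<open>The candidates for \<open>refinements\<close> before their union is prescribed, in a
  form suited to induction along \<open>c\<close>.\<close>

definition partition_families :: "nat list \<Rightarrow> nat list list set" where
  "partition_families c = {ls. list_all2 (\<turnstile>) ls c}"

lemma partition_families_Nil: "partition_families [] = {[]}"
  by (simp add: partition_families_def)

lemma partition_families_Cons:
  "partition_families (k # c) = (\<lambda>(\<nu>, ls). \<nu> # ls) ` ({\<nu>. \<nu> \<turnstile> k} \<times> partition_families c)"
  by (auto simp: partition_families_def list_all2_Cons2)

lemma finite_cycle_factorizations: "finite (cycle_factorizations a k)"
proof (rule finite_subset)
  show "cycle_factorizations a k \<subseteq> {l. set l \<subseteq> {a..a + k} \<times> {a..a + k} \<and> length l = k}"
    by (auto simp: cycle_factorizations_def mono_factorizations_def)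
  show "finite {l. set l \<subseteq> {a..a + k} \<times> {a..a + k} \<and> length l = k}"
    by (intro finite_lists_length_eq) simp
qed

text \<open>The weight \<open>h\<close> is arbitrary so that the induction can absorb the type of
  the first block into it. Minimal factorizations of the blocks are independent, and their types add
  up as multisets.\<close>

lemma sum_block_factorizations:
  fixes h :: "nat multiset \<Rightarrow> nat"
  shows "(\<Sum>l\<in>block_factorizations a c. h (mset (seq_type (map snd l)))) =
    (\<Sum>ls\<in>partition_families c. h (mset (concat ls)) * prod_list (map RC ls))"
proof (induction c arbitrary: a h)
  case Nil
  show ?case by (simp add: block_factorizations_Nil partition_families_Nil seq_type_def sort_desc_def)
next
  case (Cons k c)
  let ?F = "cycle_factorizations a k" and ?B = "block_factorizations (Suc (a + k)) c"
  let ?ty = "\<lambda>l :: (nat \<times> nat) list. seq_type (map snd l)"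
  define H where "H \<nu> =
    (\<Sum>ls\<in>partition_families c. h (mset \<nu> + mset (concat ls)) * prod_list (map RC ls))" for \<nu>
  have type_append: "mset (?ty (l1 @ l2)) = mset (?ty l1) + mset (?ty l2)"
    if "l1 \<in> ?F" "l2 \<in> ?B" for l1 l2
  proof -
    have "snd x \<le> a + k" if "x \<in> set l1" for x
      using that \<open>l1 \<in> ?F\<close> by (fastforce simp: cycle_factorizations_def mono_factorizations_def)
    moreover have "a + k < snd x" if "x \<in> set l2" for x
      using that \<open>l2 \<in> ?B\<close> by (fastforce simp: block_factorizations_def mono_factorizations_def)
    ultimately have "set (map snd l1) \<inter> set (map snd l2) = {}" by fastforce
    then show ?thesis unfolding map_append by (rule mset_seq_type_append)
  qed
  \<comment> \<open>Concatenation can be undone because all first parts have the same length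
    \<open>k\<close>.\<close>
  have inj: "inj_on (\<lambda>(l1, l2). l1 @ l2) (?F \<times> ?B)"
    by (auto simp: inj_on_def cycle_factorizations_def)
  have "(\<Sum>l\<in>block_factorizations a (k # c). h (mset (?ty l))) =
      (\<Sum>(l1, l2)\<in>?F \<times> ?B. h (mset (?ty (l1 @ l2))))"
    unfolding block_factorizations_Cons sum.reindex[OF inj] by (simp add: case_prod_unfold comp_def)
  also have "\<dots> = (\<Sum>l1\<in>?F. \<Sum>l2\<in>?B. h (mset (?ty (l1 @ l2))))"
    by (rule sum.cartesian_product[symmetric])
  also have "\<dots> = (\<Sum>l1\<in>?F. \<Sum>l2\<in>?B. h (mset (?ty l1) + mset (?ty l2)))"
    by (intro sum.cong refl) (simp add: type_append del: map_append)
  \<comment> \<open>The induction hypothesis is used for the weight shifted by the type of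
    \<open>l1\<close>.\<close>
  also have "\<dots> = (\<Sum>l1\<in>?F. H (?ty l1))"
    unfolding H_def by (intro sum.cong refl Cons.IH[of "\<lambda>M. h (mset (?ty _) + M)"])
  also have "\<dots> = (\<Sum>\<nu> | \<nu> \<turnstile> k. \<Sum>l1\<in>{l1 \<in> ?F. ?ty l1 = \<nu>}. H (?ty l1))"
  proof (rule sum.group[symmetric, OF finite_cycle_factorizations finite_partition_of])
    show "?ty ` ?F \<subseteq> {\<nu>. \<nu> \<turnstile> k}"
      using seq_type_partition[of "map snd _"] by (auto simp: cycle_factorizations_def)
  qed
  also have "\<dots> = (\<Sum>\<nu> | \<nu> \<turnstile> k. RC \<nu> * H \<nu>)"
    by (intro sum.cong refl) (simp add: card_cycle_factorizations_type)
  also have "\<dots> = (\<Sum>\<nu> | \<nu> \<turnstile> k. \<Sum>ls\<in>partition_families c.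
      h (mset (concat (\<nu> # ls))) * prod_list (map RC (\<nu> # ls)))"
    unfolding H_def sum_distrib_left by (intro sum.cong refl) simp
  also have "\<dots> = (\<Sum>(\<nu>, ls)\<in>{\<nu>. \<nu> \<turnstile> k} \<times> partition_families c.
      h (mset (concat (\<nu> # ls))) * prod_list (map RC (\<nu> # ls)))"
    by (rule sum.cartesian_product)
  also have "\<dots> = (\<Sum>ls\<in>partition_families (k # c). h (mset (concat ls)) * prod_list (map RC ls))"
    unfolding partition_families_Cons
    by (subst sum.reindex) (auto simp: inj_on_def case_prod_unfold comp_def intro: sum.cong)
  finally show ?case .
qed

text \<open>A one-point block admits only the empty partition.\<close>

lemma partition_families_append_zeros:
  "partition_families (c @ replicate r 0) = (\<lambda>ls. ls @ replicate r []) ` partition_families c"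
proof -
  have "list_all2 (\<turnstile>) ls (replicate r 0) \<longleftrightarrow> ls = replicate r []" for ls
    by (induction r arbitrary: ls) (auto simp: list_all2_Cons2 partition_of_0_iff)
  then show ?thesis by (auto simp: partition_families_def list_all2_append2 image_iff)
    (metis list_all2_lengthD)
qed

lemma finite_partition_families: "finite (partition_families c)"
  by (induction c) (simp_all add: partition_families_Nil partition_families_Cons finite_partition_of)

lemma refinements_eq:
  assumes "is_partition lam"
  shows "refinements lam \<mu> = {ls \<in> partition_families \<mu>. mset (concat ls) = mset lam}"
proof -
  have "sorted_wrt (\<ge>) lam" using assms by (simp add: is_partition_def)
  then show ?thesis
    by (auto simp: refinements_def partition_families_def list_all2_conv_all_nth sort_desc_mset_eq_iff)
qed

text \<open>Pad \<open>\<mu>\<close> with fixed points up to \<open>n\<close> and sum the indicator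
  of the type \<open>lam\<close> over the minimal factorizations.\<close>

lemma card_mono_factorizations_type_refinements:
  assumes lam: "is_partition lam" and sum: "sum_list lam = sum_list \<mu>" and n: "wt \<mu> \<le> n"
  shows "card (mono_factorizations_type lam {1..n} (block_perm 1 \<mu>)) =
    (\<Sum>ls\<in>refinements lam \<mu>. prod_list (map RC ls))"
proof -
  define r where "r = n - wt \<mu>"
  let ?c = "\<mu> @ replicate r 0"
  let ?P = "\<lambda>M. if M = mset lam then 1 else 0 :: nat"
  have rng: "{1..n} = {1..<1 + wt ?c}" using n by (auto simp: r_def)
  have "mono_factorizations_type lam {1..n} (block_perm 1 \<mu>) =
      {l \<in> block_factorizations 1 ?c. mset (seq_type (map snd l)) = mset lam}"
  proof -
    \<comment> \<open>The type determines the length, and equality of the two sums makes this length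
      the minimal one.\<close>
    have "seq_type ts = lam \<longleftrightarrow> length ts = sum_list ?c \<and> mset (seq_type ts) = mset lam" for ts
      using seq_type_eq_iff[of lam ts] lam sum sum_list_seq_type[of ts]
      by (auto simp: is_partition_def sum_list_replicate)
    then show ?thesis
      unfolding mono_factorizations_type_def block_factorizations_def rng block_perm_append_zeros
      by (auto simp del: One_nat_def)
  qed
  moreover have fin: "finite (block_factorizations a c)" for a c
  proof (induction c arbitrary: a)
    case (Cons k c)
    then show ?case by (simp add: block_factorizations_Cons finite_cycle_factorizations)
  qed (simp add: block_factorizations_Nil)
  ultimately have "card (mono_factorizations_type lam {1..n} (block_perm 1 \<mu>)) =
      (\<Sum>l\<in>block_factorizations 1 ?c. ?P (mset (seq_type (map snd l))))"
    by (simp add: sum.If_cases Int_def del: One_nat_def)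
  also have "\<dots> = (\<Sum>ls\<in>partition_families ?c. ?P (mset (concat ls)) * prod_list (map RC ls))"
    by (rule sum_block_factorizations)
  \<comment> \<open>Fixed points contribute empty partitions, each with \<open>RC\<close> equal to
    1, so the dependence on \<open>n\<close> disappears.\<close>
  also have "\<dots> = (\<Sum>ls\<in>partition_families \<mu>. ?P (mset (concat ls)) * prod_list (map RC ls))"
    unfolding partition_families_append_zeros
    by (subst sum.reindex) (auto simp: inj_on_def RC_def prod_list_replicate)
  also have "\<dots> = (\<Sum>ls\<in>refinements lam \<mu>. prod_list (map RC ls))"
    unfolding refinements_eq[OF lam] sum.inter_filter[OF finite_partition_families]
    by (intro sum.cong) auto
  finally show ?thesis .
qed

theorem theorem5p9:
  fixes lam \<mu> :: "nat list"
  assumes "is_partition lam" and "is_partition \<mu>" and "sum_list lam = sum_list \<mu>"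
  shows "(\<forall>t. poly (L_poly lam \<mu>) t = of_nat (\<Sum>ls\<in>refinements lam \<mu>. prod_list (map RC ls))) \<and>
         (\<forall>s t. poly (L_poly lam \<mu>) s = poly (L_poly lam \<mu>) t) \<and>
         (\<not> is_refinement lam \<mu> \<longrightarrow> L_poly lam \<mu> = 0)"
proof -
  define K where "K = (\<Sum>ls\<in>refinements lam \<mu>. prod_list (map RC ls))"
  have L: "L_poly lam \<mu> = [:of_nat K:]"
  \<comment> \<open>The count has the same value \<open>K\<close> for every large \<open>n\<close>,
    which forces the polynomial to be constant.\<close>
  proof (rule poly_eq_of_nat_values)
    fix n assume n: "max 1 (wt \<mu>) \<le> n"
    have "poly (L_poly lam \<mu>) (of_nat n) =
        of_nat (card (mono_factorizations_type lam {1..n} (block_perm 1 \<mu>)))"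
      unfolding L_poly_def using n by (intro poly_class_poly_monomial_sym assms) auto
    also have "\<dots> = of_nat K"
      unfolding K_def using card_mono_factorizations_type_refinements[OF assms(1,3)] n by simp
    finally show "poly (L_poly lam \<mu>) (of_nat n) = poly [:of_nat K:] (of_nat n)" by simp
  qed
  have "K = 0" if "\<not> is_refinement lam \<mu>"
    using that by (simp add: K_def is_refinement_def)
  then show ?thesis by (simp add: L flip: K_def)
qed

end
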